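(* Assume that the constant function $1$ belongs to $V_h^{2,c}$ and the constant vector fields $\mathbf e_1,\mathbf e_2$ belong to $V_h^{1,c}$. Let $\nu\ge 0$, $T>0$, and let $(\mathbf u_h,p_h):[0,T]\to V_h^{1,c}\times V_h^{2,c}$ ($\mathbf u_h$ being $C^1$ in time), with $\operatorname{div}(\mathbf u_h(0))=0$, be a solution of the conforming semi-discrete incompressible Navier--Stokes scheme: for all $t$, $$\int_\Omega \frac{\partial \mathbf u_h}{\partial t}\cdot \mathbf v_h+\int_\Omega \mathbf u_h\cdot s_h(\mathbf u_h,\mathbf v_h)+\int_\Omega (\widetilde{\mathrm{grad}}_h\, p_h)\cdot \mathbf v_h+\nu\int_\Omega (\widetilde{\mathrm{curl}}_h\,\mathbf u_h)(\widetilde{\mathrm{curl}}_h\,\mathbf v_h)=0\quad\forall\,\mathbf v_h\in V_h^{1,c},$$ $$\int_\Omega \mathbf u_h\cdot s_h(\mathbf u_h,\widetilde{\mathrm{grad}}_h\, q_h)+\int_\Omega \widetilde{\mathrm{grad}}_h\, p_h\cdot\widetilde{\mathrm{grad}}_h\, q_h=0\quad\forall\, q_h\in V_h^{2,c}.$$ Then the momentum is preserved: $\frac{\partial}{\partial t}\int_\Omega\mathbf u_h=0$.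
   Context: Setting (dimension $d=2$). $\Omega$ is a two-dimensional domain with either periodic boundary conditions (a rectangle with opposite sides identified; all function spaces are spaces of periodic functions: $V^0=H^1(\Omega)$, $V^1=H(\mathrm{div};\Omega)$, $V^2=L^2(\Omega)$) or homogeneous boundary conditions on a bounded Lipschitz domain ($V^0=H^1_0(\Omega)$, $V^1=H_0(\mathrm{div};\Omega)$, $V^2=L^2(\Omega)$). For scalar $\omega$, $\operatorname{curl}\omega=(\partial_2\omega,-\partial_1\omega)$. Discrete spaces: $V_h^{\ell,c}\subset V^\ell$, $\ell=0,1,2$, are finite-dimensional (finite element) spaces of bounded functions with $\operatorname{curl}V_h^{0,c}\subset V_h^{1,c}$ and $\operatorname{div}V_h^{1,c}\subset V_h^{2,c}$ (and there are projections $\Pi_\ell:V^\ell\to V_h^{\ell,c}$ with $\operatorname{curl}\Pi_0=\Pi_1\operatorname{curl}$ and $\operatorname{div}\Pi_1=\Pi_2\operatorname{div}$). Discrete dual operators: $\widetilde{\mathrm{grad}}_h:V_h^{2,c}\to V_h^{1,c}$ and $\widetilde{\mathrm{curl}}_h:V_h^{1,c}\to V_h^{0,c}$ are defined by $\int_\Omega \widetilde{\mathrm{grad}}_h q_h\cdot\mathbf v_h=-\int_\Omega q_h\operatorname{div}\mathbf v_h$ and $\int_\Omega(\widetilde{\mathrm{curl}}_h\mathbf v_h)\,\omega_h=\int_\Omega\mathbf v_h\cdot\operatorname{curl}\omega_h$ for all $q_h\in V_h^{2,c}$, $\mathbf v_h\in V_h^{1,c}$, $\omega_h\in V_h^{0,c}$.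 Discrete interior product: for a vector $\mathbf a\in\mathbb R^2$, $\tilde\imath^{0h}_{\mathbf a}\mathbf u_h=\tilde P_h^0(\mathbf a\cdot\mathbf u_h)$, with $\tilde P_h^0$ the $L^2$-orthogonal projection onto $V_h^{2,c}$. With $\mathbf e_1,\mathbf e_2$ the canonical basis and $P_h^1$ the $L^2$-orthogonal projection onto $V_h^{1,c}$, $$s_h(\mathbf u_h,\mathbf v_h)=\tfrac12P_h^1\Big(\sum_{k=1}^{2}(\tilde\imath^{0h}_{\mathbf e_k}\mathbf v_h)\,\widetilde{\mathrm{grad}}_h(\tilde\imath^{0h}_{\mathbf e_k}\mathbf u_h)-(\tilde\imath^{0h}_{\mathbf e_k}\mathbf u_h)\,\widetilde{\mathrm{grad}}_h(\tilde\imath^{0h}_{\mathbf e_k}\mathbf v_h)\Big).$$ *)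

theory Defs
  imports "HOL-Analysis.Analysis"
begin

text \<open>
  Elements of the function spaces are represented by functions on the whole plane, of which only the
  values almost everywhere on the domain matter. For \<open>Periodic a b\<close> the domain is one open periodicity
  cell: a function on the torus is determined almost everywhere by its values on that cell, and
  periodicity is encoded by the periodic test functions in the weak derivatives.
\<close>

datatype flow_domain = Periodic "real^2" "real^2" | Homogeneous "(real^2) set"

fun region :: "flow_domain \<Rightarrow> (real^2) set" where
  "region (Periodic a b) = box a b"
| "region (Homogeneous W) = W"

abbreviation vol :: "flow_domain \<Rightarrow> (real^2) measure" where
  "vol D \<equiv> lebesgue_on (region D)"

text \<open>Near each boundary point, after a rotation or reflection, the domain is the strict epigraph of a
  Lipschitz function.\<close>

definition lipschitz_domain :: "(real^2) set \<Rightarrow> bool" where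
  "lipschitz_domain W \<longleftrightarrow> W \<noteq> {} \<and> open W \<and> connected W \<and>
     (\<forall>z\<in>frontier W. \<exists>r>0. \<exists>(R :: real^2 \<Rightarrow> real^2) (\<gamma> :: real \<Rightarrow> real) L.
        orthogonal_transformation R \<and> L-lipschitz_on UNIV \<gamma> \<and>
        W \<inter> ball z r = {x \<in> ball z r. \<gamma> (R x $ 1) < R x $ 2})"

fun admissible_domain :: "flow_domain \<Rightarrow> bool" where
  "admissible_domain (Periodic a b) \<longleftrightarrow> (\<forall>i. a $ i < b $ i)"
| "admissible_domain (Homogeneous W) \<longleftrightarrow> bounded W \<and> lipschitz_domain W"

definition pd :: "2 \<Rightarrow> (real^2 \<Rightarrow> real) \<Rightarrow> real^2 \<Rightarrow> real" where
  "pd i f x = frechet_derivative f (at x) (axis i 1)"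

definition grad :: "(real^2 \<Rightarrow> real) \<Rightarrow> real^2 \<Rightarrow> real^2" where
  "grad f x = (\<chi> i. pd i f x)"

fun Ck :: "nat \<Rightarrow> (real^2 \<Rightarrow> real) \<Rightarrow> bool" where
  "Ck 0 f \<longleftrightarrow> continuous_on UNIV f"
| "Ck (Suc k) f \<longleftrightarrow> (\<forall>x. f differentiable (at x)) \<and> (\<forall>i. Ck k (pd i f))"

definition smooth :: "(real^2 \<Rightarrow> real) \<Rightarrow> bool" where
  "smooth f \<longleftrightarrow> (\<forall>k. Ck k f)"

fun test_functions :: "flow_domain \<Rightarrow> (real^2 \<Rightarrow> real) set" where
  "test_functions (Periodic a b) =
     {\<phi>. smooth \<phi> \<and> (\<forall>i x. \<phi> (x + axis i (b $ i - a $ i)) = \<phi> x)}"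
| "test_functions (Homogeneous W) =
     {\<phi>. smooth \<phi> \<and> (\<exists>K. compact K \<and> K \<subseteq> W \<and> (\<forall>x. x \<notin> K \<longrightarrow> \<phi> x = 0))}"

definition test_fields :: "flow_domain \<Rightarrow> (real^2 \<Rightarrow> real^2) set" where
  "test_fields D = {\<psi>. \<forall>i. (\<lambda>x. \<psi> x $ i) \<in> test_functions D}"

definition L2 :: "flow_domain \<Rightarrow> (real^2 \<Rightarrow> 'a::euclidean_space) set" where
  "L2 D = {f \<in> borel_measurable (vol D). integrable (vol D) (\<lambda>x. (norm (f x))\<^sup>2)}"

definition L2_norm :: "flow_domain \<Rightarrow> (real^2 \<Rightarrow> 'a::euclidean_space) \<Rightarrow> real" where
  "L2_norm D f = sqrt (LINT x|vol D. (norm (f x))\<^sup>2)"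

definition has_weak_pd :: "flow_domain \<Rightarrow> 2 \<Rightarrow> (real^2 \<Rightarrow> real) \<Rightarrow> (real^2 \<Rightarrow> real) \<Rightarrow> bool" where
  "has_weak_pd D i f g \<longleftrightarrow> g \<in> L2 D \<and>
     (\<forall>\<phi>\<in>test_functions D. (LINT x|vol D. f x * pd i \<phi> x) = - (LINT x|vol D. g x * \<phi> x))"

definition has_weak_div :: "flow_domain \<Rightarrow> (real^2 \<Rightarrow> real^2) \<Rightarrow> (real^2 \<Rightarrow> real) \<Rightarrow> bool" where
  "has_weak_div D v d \<longleftrightarrow> d \<in> L2 D \<and>
     (\<forall>\<phi>\<in>test_functions D. (LINT x|vol D. v x \<bullet> grad \<phi> x) = - (LINT x|vol D. d x * \<phi> x))"

text \<open>Weak derivatives are determined only almost everywhere; some representative is chosen, here and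
  for the projections and dual operators below.\<close>

definition weak_pd :: "flow_domain \<Rightarrow> 2 \<Rightarrow> (real^2 \<Rightarrow> real) \<Rightarrow> real^2 \<Rightarrow> real" where
  "weak_pd D i f = (SOME g. has_weak_pd D i f g)"

definition weak_div :: "flow_domain \<Rightarrow> (real^2 \<Rightarrow> real^2) \<Rightarrow> real^2 \<Rightarrow> real" where
  "weak_div D v = (SOME d. has_weak_div D v d)"

definition weak_curl :: "flow_domain \<Rightarrow> (real^2 \<Rightarrow> real) \<Rightarrow> real^2 \<Rightarrow> real^2" where
  "weak_curl D w x = vector [weak_pd D 2 w x, - weak_pd D 1 w x]"

definition H1 :: "flow_domain \<Rightarrow> (real^2 \<Rightarrow> real) set" where
  "H1 D = {f \<in> L2 D. \<forall>i. \<exists>g. has_weak_pd D i f g}"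

definition Hdiv :: "flow_domain \<Rightarrow> (real^2 \<Rightarrow> real^2) set" where
  "Hdiv D = {v \<in> L2 D. \<exists>d. has_weak_div D v d}"

text \<open>Homogeneous boundary conditions: closure of the compactly supported smooth functions (fields) in
  the graph norm.\<close>

definition H1_zero :: "flow_domain \<Rightarrow> (real^2 \<Rightarrow> real) set" where
  "H1_zero D = {f \<in> H1 D. \<exists>\<phi> :: nat \<Rightarrow> real^2 \<Rightarrow> real.
     (\<forall>n. \<phi> n \<in> test_functions D) \<and>
     (\<lambda>n. L2_norm D (\<lambda>x. \<phi> n x - f x)) \<longlonglongrightarrow> 0 \<and>
     (\<forall>i. (\<lambda>n. L2_norm D (\<lambda>x. pd i (\<phi> n) x - weak_pd D i f x)) \<longlonglongrightarrow> 0)}"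

definition Hdiv_zero :: "flow_domain \<Rightarrow> (real^2 \<Rightarrow> real^2) set" where
  "Hdiv_zero D = {v \<in> Hdiv D. \<exists>\<psi> :: nat \<Rightarrow> real^2 \<Rightarrow> real^2.
     (\<forall>n. \<psi> n \<in> test_fields D) \<and>
     (\<lambda>n. L2_norm D (\<lambda>x. \<psi> n x - v x)) \<longlonglongrightarrow> 0 \<and>
     (\<lambda>n. L2_norm D (\<lambda>x. (\<Sum>i\<in>UNIV. pd i (\<lambda>y. \<psi> n y $ i) x) - weak_div D v x)) \<longlonglongrightarrow> 0}"

fun V0 :: "flow_domain \<Rightarrow> (real^2 \<Rightarrow> real) set" where
  "V0 (Periodic a b) = H1 (Periodic a b)"
| "V0 (Homogeneous W) = H1_zero (Homogeneous W)"

fun V1 :: "flow_domain \<Rightarrow> (real^2 \<Rightarrow> real^2) set" where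
  "V1 (Periodic a b) = Hdiv (Periodic a b)"
| "V1 (Homogeneous W) = Hdiv_zero (Homogeneous W)"

definition V2 :: "flow_domain \<Rightarrow> (real^2 \<Rightarrow> real) set" where
  "V2 D = L2 D"

text \<open>A finite-dimensional space of (essentially) bounded functions modulo equality almost everywhere,
  represented by the set of all representatives of its members.\<close>

definition discrete_space :: "flow_domain \<Rightarrow> (real^2 \<Rightarrow> 'a::euclidean_space) set \<Rightarrow> bool" where
  "discrete_space D V \<longleftrightarrow>
     (\<lambda>x. 0) \<in> V \<and>
     (\<forall>f\<in>V. \<forall>g\<in>V. (\<lambda>x. f x + g x) \<in> V) \<and>
     (\<forall>f\<in>V. \<forall>c::real. (\<lambda>x. c *\<^sub>R f x) \<in> V) \<and>
     (\<forall>f\<in>V. \<forall>g. (AE x in vol D. f x = g x) \<longrightarrow> g \<in> V) \<and>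
     (\<exists>B\<subseteq>V. finite B \<and> (\<forall>f\<in>V. \<exists>c. AE x in vol D. f x = (\<Sum>b\<in>B. c b *\<^sub>R b x))) \<and>
     (\<forall>f\<in>V. \<exists>C. AE x in vol D. norm (f x) \<le> C)"

text \<open>Linear projections, acting on functions modulo equality almost everywhere.\<close>

definition projection_onto ::
  "flow_domain \<Rightarrow> (real^2 \<Rightarrow> 'a::euclidean_space) set \<Rightarrow> (real^2 \<Rightarrow> 'a) set \<Rightarrow>
   ((real^2 \<Rightarrow> 'a) \<Rightarrow> real^2 \<Rightarrow> 'a) \<Rightarrow> bool" where
  "projection_onto D V Vh P \<longleftrightarrow>
     (\<forall>f\<in>V. P f \<in> Vh) \<and>
     (\<forall>f\<in>Vh. AE x in vol D. P f x = f x) \<and>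
     (\<forall>f\<in>V. \<forall>g\<in>V. (AE x in vol D. f x = g x) \<longrightarrow> (AE x in vol D. P f x = P g x)) \<and>
     (\<forall>f\<in>V. \<forall>g\<in>V. AE x in vol D. P (\<lambda>y. f y + g y) x = P f x + P g x) \<and>
     (\<forall>f\<in>V. \<forall>c::real. AE x in vol D. P (\<lambda>y. c *\<^sub>R f y) x = c *\<^sub>R P f x)"

definition conforming_spaces ::
  "flow_domain \<Rightarrow> (real^2 \<Rightarrow> real) set \<Rightarrow> (real^2 \<Rightarrow> real^2) set \<Rightarrow> (real^2 \<Rightarrow> real) set \<Rightarrow> bool" where
  "conforming_spaces D V0h V1h V2h \<longleftrightarrow>
     admissible_domain D \<and>
     discrete_space D V0h \<and> discrete_space D V1h \<and> discrete_space D V2h \<and>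
     V0h \<subseteq> V0 D \<and> V1h \<subseteq> V1 D \<and> V2h \<subseteq> V2 D \<and>
     (\<forall>w\<in>V0h. weak_curl D w \<in> V1h) \<and> (\<forall>v\<in>V1h. weak_div D v \<in> V2h) \<and>
     (\<exists>\<Pi>0 \<Pi>1 \<Pi>2.
        projection_onto D (V0 D) V0h \<Pi>0 \<and>
        projection_onto D (V1 D) V1h \<Pi>1 \<and>
        projection_onto D (V2 D) V2h \<Pi>2 \<and>
        (\<forall>w\<in>V0 D. AE x in vol D. weak_curl D (\<Pi>0 w) x = \<Pi>1 (weak_curl D w) x) \<and>
        (\<forall>v\<in>V1 D. AE x in vol D. weak_div D (\<Pi>1 v) x = \<Pi>2 (weak_div D v) x))"

definition L2_proj ::
  "flow_domain \<Rightarrow> (real^2 \<Rightarrow> 'a::euclidean_space) set \<Rightarrow> (real^2 \<Rightarrow> 'a) \<Rightarrow> real^2 \<Rightarrow> 'a" where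
  "L2_proj D V f = (SOME g. g \<in> V \<and>
     (\<forall>h\<in>V. (LINT x|vol D. g x \<bullet> h x) = (LINT x|vol D. f x \<bullet> h x)))"

definition grad_h ::
  "flow_domain \<Rightarrow> (real^2 \<Rightarrow> real^2) set \<Rightarrow> (real^2 \<Rightarrow> real) \<Rightarrow> real^2 \<Rightarrow> real^2" where
  "grad_h D V1h q = (SOME g. g \<in> V1h \<and>
     (\<forall>v\<in>V1h. (LINT x|vol D. g x \<bullet> v x) = - (LINT x|vol D. q x * weak_div D v x)))"

definition curl_h ::
  "flow_domain \<Rightarrow> (real^2 \<Rightarrow> real) set \<Rightarrow> (real^2 \<Rightarrow> real^2) \<Rightarrow> real^2 \<Rightarrow> real" where
  "curl_h D V0h v = (SOME z. z \<in> V0h \<and>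
     (\<forall>w\<in>V0h. (LINT x|vol D. z x * w x) = (LINT x|vol D. v x \<bullet> weak_curl D w x)))"

definition interior_h ::
  "flow_domain \<Rightarrow> (real^2 \<Rightarrow> real) set \<Rightarrow> real^2 \<Rightarrow> (real^2 \<Rightarrow> real^2) \<Rightarrow> real^2 \<Rightarrow> real" where
  "interior_h D V2h a u = L2_proj D V2h (\<lambda>x. a \<bullet> u x)"

definition s_h ::
  "flow_domain \<Rightarrow> (real^2 \<Rightarrow> real^2) set \<Rightarrow> (real^2 \<Rightarrow> real) set \<Rightarrow>
   (real^2 \<Rightarrow> real^2) \<Rightarrow> (real^2 \<Rightarrow> real^2) \<Rightarrow> real^2 \<Rightarrow> real^2" where
  "s_h D V1h V2h u v x = (1/2) *\<^sub>R L2_proj D V1h (\<lambda>y. \<Sum>k\<in>UNIV.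
     interior_h D V2h (axis k 1) v y *\<^sub>R grad_h D V1h (interior_h D V2h (axis k 1) u) y -
     interior_h D V2h (axis k 1) u y *\<^sub>R grad_h D V1h (interior_h D V2h (axis k 1) v) y) x"

text \<open>\<open>u\<close> is a \<open>C\<^sup>1\<close> curve in the discrete space \<open>Vh\<close> on \<open>{0..T}\<close>, with time derivative \<open>u'\<close>, for the
  \<open>L\<^sup>2\<close> norm (all norms on \<open>Vh\<close> being equivalent).\<close>

definition C1_curve ::
  "flow_domain \<Rightarrow> real \<Rightarrow> (real^2 \<Rightarrow> 'a::euclidean_space) set \<Rightarrow>
   (real \<Rightarrow> real^2 \<Rightarrow> 'a) \<Rightarrow> (real \<Rightarrow> real^2 \<Rightarrow> 'a) \<Rightarrow> bool" where
  "C1_curve D T Vh u u' \<longleftrightarrow> (\<forall>t\<in>{0..T}. u t \<in> Vh \<and> u' t \<in> Vh \<and>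
     ((\<lambda>s. L2_norm D (\<lambda>x. (1 / (s - t)) *\<^sub>R (u s x - u t x) - u' t x)) \<longlongrightarrow> 0) (at t within {0..T}) \<and>
     ((\<lambda>s. L2_norm D (\<lambda>x. u' s x - u' t x)) \<longlongrightarrow> 0) (at t within {0..T}))"

end

theory Submission
  imports Defs
begin

text \<open>
  Test the scheme with \<open>v = e_i\<close>. The pressure term vanishes since \<open>div e_i = 0\<close>, the viscous term since
  the discrete curl of \<open>e_i\<close> vanishes. As constants lie in \<open>V2h\<close> and the discrete gradient of a constant
  vanishes, the convective term is \<open>\<integral> u \<bullet> s_h(u, e_i) = 1/2 \<integral> u \<bullet> grad_h (P u_i)\<close>, where \<open>P\<close> is the projection
  onto \<open>V2h\<close>; this is zero once \<open>u\<close> is divergence free. For the latter, test with \<open>v = grad_h q\<close>: by the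
  pressure equation and \<open>curl_h grad_h = 0\<close> the integral \<open>\<integral> u \<bullet> grad_h q\<close> is constant in time.

  That the discrete operators exist at all rests on the weak divergence being unique, that is, on the
  fundamental lemma of the calculus of variations on the periodicity cell. With homogeneous boundary
  conditions the hypotheses are contradictory: a constant field \<open>e_i\<close> has nonzero normal trace.
\<close>

text \<open>The discrete operators are choices (\<open>SOME\<close>), so nothing can be said of
  \<open>grad_h\<close> before some function is shown to have its defining property. That is a Riesz
  argument, and it needs the integral of \<open>q * weak_div D v\<close> to be linear in
  \<open>v\<close>. But \<open>weak_div\<close> chooses a representative for each field separately:
  additivity can hold only almost everywhere, and uniqueness is what gives it. The approximants for
  the fundamental lemma must be smooth, periodic and within reach of the inductive definition
  \<open>Ck\<close>. Composing \<open>logistic\<close> with a cosine gives all three: periodicity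
  needs no gluing, and the derivatives of both functions stay within their own family. Both
  vanishing statements about constants have one source: the function 1 is a periodic test function,
  so weak derivatives and weak divergences have mean zero. The identity
  \<open>curl_h grad_h = 0\<close> is dual to \<open>div curl = 0\<close>, which rests on the
  symmetry of second derivatives of test functions. "Divergence free" at later times means only that
  \<open>u t\<close> is orthogonal to every discrete gradient.\<close>

section \<open>Closure properties of smooth functions\<close>

lemma pd_eqI: "(f has_derivative f') (at x) \<Longrightarrow> pd i f x = f' (axis i 1)"
  unfolding pd_def by (metis frechet_derivative_at)

text \<open>\<open>Ck\<close> asks for continuity of the last derivatives only; for the lower ones
  it comes from differentiability.\<close>

lemma Ck_Suc_imp: "Ck (Suc k) f \<Longrightarrow> Ck k f"
proof (induction k arbitrary: f)
  case 0
  then show ?case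
    by (auto simp: continuous_on_eq_continuous_within differentiable_imp_continuous_within)
qed auto

lemma Ck_const: "Ck k (\<lambda>x. c)"
proof (induction k arbitrary: c)
  case (Suc k)
  have "pd i (\<lambda>x. c) = (\<lambda>x. 0)" for i
    by (rule ext) (simp add: pd_eqI[OF has_derivative_const])
  then show ?case using Suc by simp
qed simp

lemma pd_add:
  assumes "f differentiable (at x)" "g differentiable (at x)"
  shows "pd i (\<lambda>x. f x + g x) x = pd i f x + pd i g x"
  using pd_eqI[OF has_derivative_add[OF assms[unfolded frechet_derivative_works]]]
  by (simp add: pd_def)

lemma pd_mult:
  assumes "f differentiable (at x)" "g differentiable (at x)"
  shows "pd i (\<lambda>x. f x * g x) x = f x * pd i g x + pd i f x * g x"
  using pd_eqI[OF has_derivative_mult[OF assms[unfolded frechet_derivative_works]]]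
  by (simp add: pd_def)

lemma Ck_add: "Ck k f \<Longrightarrow> Ck k g \<Longrightarrow> Ck k (\<lambda>x. f x + g x)"
proof (induction k arbitrary: f g)
  case (Suc k)
  have "pd i (\<lambda>x. f x + g x) = (\<lambda>x. pd i f x + pd i g x)" for i
    using Suc.prems by (auto simp: fun_eq_iff pd_add)
  then show ?case using Suc by auto
qed (auto intro: continuous_intros)

lemma Ck_mult: "Ck k f \<Longrightarrow> Ck k g \<Longrightarrow> Ck k (\<lambda>x. f x * g x)"
proof (induction k arbitrary: f g)
  case (Suc k)
  have "pd i (\<lambda>x. f x * g x) = (\<lambda>x. f x * pd i g x + pd i f x * g x)" for i
    using Suc.prems by (auto simp: fun_eq_iff pd_mult)
  moreover have "Ck k f" "Ck k g"
    using Suc.prems Ck_Suc_imp by blast+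
  ultimately show ?case using Suc by (auto intro!: Ck_add)
qed (auto intro: continuous_intros)

lemma Ck_component: "Ck k (\<lambda>x. x $ i)"
proof (cases k)
  case (Suc n)
  have d: "((\<lambda>x::real^2. x $ i) has_derivative (\<lambda>h. h $ i)) (at x)" for x
    by (rule bounded_linear.has_derivative[OF bounded_linear_vec_nth]) (rule has_derivative_ident)
  have "pd j (\<lambda>x. x $ i) = (\<lambda>x. axis j 1 $ i)" for j
    using pd_eqI[OF d] by auto
  with d show ?thesis by (auto simp: Suc Ck_const differentiable_def)
qed (auto intro: continuous_intros)

text \<open>Since \<open>- sin y = cos (y + pi / 2)\<close>, differentiation only multiplies by a
  constant and shifts the phase. This is why the induction leaves \<open>\<beta>\<close>
  arbitrary.\<close>

lemma Ck_cos: "Ck k (\<lambda>x. cos (\<alpha> * x $ i + \<beta>))"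
proof (induction k arbitrary: \<beta>)
  case (Suc k)
  have d: "((\<lambda>x::real^2. cos (\<alpha> * x $ i + \<beta>)) has_derivative (\<lambda>h. - sin (\<alpha> * x $ i + \<beta>) * (\<alpha> * h $ i))) (at x)" for x
    by (auto intro!: derivative_eq_intros bounded_linear.has_derivative[OF bounded_linear_vec_nth])
  have "pd j (\<lambda>x. cos (\<alpha> * x $ i + \<beta>)) =
      (\<lambda>x. (\<alpha> * axis j 1 $ i) * cos (\<alpha> * x $ i + (\<beta> + pi / 2)))" for j
  proof
    fix x :: "real^2"
    have "- sin (\<alpha> * x $ i + \<beta>) = cos (\<alpha> * x $ i + (\<beta> + pi / 2))"
      by (simp add: minus_sin_cos_eq add.assoc)
    with pd_eqI[OF d, of j x] show "pd j (\<lambda>x. cos (\<alpha> * x $ i + \<beta>)) x =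
      (\<alpha> * axis j 1 $ i) * cos (\<alpha> * x $ i + (\<beta> + pi / 2))" by (simp add: mult.commute)
  qed
  with Suc d show ?case by (auto simp: differentiable_def intro!: Ck_mult Ck_const)
qed (auto intro!: continuous_intros)

text \<open>A smooth substitute for a step function. Its derivative is a polynomial in the function
  itself, so all orders of smoothness follow by induction without a formula for higher
  derivatives.\<close>

definition logistic :: "real \<Rightarrow> real" where
  "logistic y = 1 / (1 + exp (- y))"

lemma logistic_bounds: "0 < logistic y" "logistic y < 1"
  by (auto simp: logistic_def add_pos_pos divide_simps)

lemma logistic_derivative: "(logistic has_real_derivative logistic y * (1 - logistic y)) (at y)"
proof -
  have p: "1 + exp (- y) > 0" by (simp add: add_pos_pos)
  show ?thesis
    unfolding logistic_def
    by (rule derivative_eq_intros refl | use p in \<open>simp add: field_simps power2_eq_square\<close>)+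
qed

lemma Ck_logistic: "Ck k f \<Longrightarrow> Ck k (\<lambda>x. logistic (f x))"
proof (induction k arbitrary: f)
  case 0
  have "continuous_on UNIV logistic"
    using logistic_derivative DERIV_isCont continuous_on_eq_continuous_within by blast
  then show ?case using 0 continuous_on_compose2 by force
next
  case (Suc k)
  have d: "((\<lambda>x. logistic (f x)) has_derivative
      (\<lambda>h. frechet_derivative f (at x) h * (logistic (f x) * (1 - logistic (f x))))) (at x)" for x
  proof -
    have "(f has_derivative frechet_derivative f (at x)) (at x)"
      using Suc.prems frechet_derivative_works by auto
    from has_derivative_compose[OF this logistic_derivative[unfolded has_field_derivative_def]]
    show ?thesis by (simp add: mult.commute)
  qed
  \<comment> \<open>The difference is written as \<open>1 + (-1) * ...\<close> so that the closure
    rules for sums, products and constants cover it.\<close>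
  have "pd i (\<lambda>x. logistic (f x)) =
      (\<lambda>x. pd i f x * (logistic (f x) * (1 + (-1) * logistic (f x))))" for i
    using pd_eqI[OF d] by (auto simp: pd_def)
  moreover have "Ck k f"
    using Suc.prems Ck_Suc_imp by blast
  moreover have "Ck k (\<lambda>x. 1 + (-1) * logistic (f x))"
    by (intro Ck_add Ck_mult Ck_const Suc.IH) fact
  ultimately show ?case
    using Suc d by (auto simp: differentiable_def intro!: Ck_mult)
qed

lemma smooth_add: "smooth f \<Longrightarrow> smooth g \<Longrightarrow> smooth (\<lambda>x. f x + g x)"
  and smooth_mult: "smooth f \<Longrightarrow> smooth g \<Longrightarrow> smooth (\<lambda>x. f x * g x)"
  and smooth_pd: "smooth f \<Longrightarrow> smooth (pd i f)"
  and smooth_differentiable: "smooth f \<Longrightarrow> f differentiable (at x)"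
  unfolding smooth_def by (auto intro: Ck_add Ck_mult) (metis Ck.simps(2))+

lemma smooth_continuous: "smooth f \<Longrightarrow> continuous_on S f"
  unfolding smooth_def by (metis Ck.simps(1) continuous_on_subset subset_UNIV)

section \<open>Mean values along coordinate lines and mixed partial derivatives\<close>

lemma smooth_line_derivative:
  assumes "smooth f"
  shows "((\<lambda>s. f (x + s *\<^sub>R axis i 1)) has_real_derivative pd i f (x + s *\<^sub>R axis i 1)) (at s)"
proof -
  let ?y = "x + s *\<^sub>R axis i 1"
  have f: "(f has_derivative frechet_derivative f (at ?y)) (at ?y)"
    using smooth_differentiable[OF assms] frechet_derivative_works by blast
  have "((\<lambda>s. x + s *\<^sub>R axis i 1) has_derivative (\<lambda>h. h *\<^sub>R axis i 1)) (at s)"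
    by (auto intro!: derivative_eq_intros)
  from has_derivative_compose[OF this f] show ?thesis
    unfolding has_field_derivative_def pd_def
    by (rule has_derivative_eq_rhs)
       (simp add: fun_eq_iff linear_cmul[OF linear_frechet_derivative[OF smooth_differentiable[OF assms]]])
qed

lemma smooth_mvt:
  assumes "smooth f" "h > 0"
  obtains \<xi> where "0 < \<xi>" "\<xi> < h" "f (x + h *\<^sub>R axis i 1) - f x = h * pd i f (x + \<xi> *\<^sub>R axis i 1)"
proof -
  have "\<exists>z>0. z < h \<and> f (x + h *\<^sub>R axis i 1) - f (x + 0 *\<^sub>R axis i 1) = (h - 0) * pd i f (x + z *\<^sub>R axis i 1)"
    by (rule MVT2[OF assms(2)]) (use smooth_line_derivative[OF assms(1)] in auto)
  then show ?thesis using that by auto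
qed

text \<open>The mean value theorem twice: in direction \<open>i\<close> for the increment of
  \<open>f\<close> over a step in direction \<open>j\<close>, then in direction \<open>j\<close> for
  \<open>pd i f\<close>.\<close>

lemma smooth_second_difference:
  assumes f: "smooth f" and h: "h > 0"
  obtains \<xi> \<eta> where "0 < \<xi>" "\<xi> < h" "0 < \<eta>" "\<eta> < h"
    "f (x + h *\<^sub>R axis i 1 + h *\<^sub>R axis j 1) - f (x + h *\<^sub>R axis i 1) - f (x + h *\<^sub>R axis j 1) + f x
      = h\<^sup>2 * pd j (pd i f) (x + \<xi> *\<^sub>R axis i 1 + \<eta> *\<^sub>R axis j 1)"
proof -
  let ?g = "\<lambda>s. f ((x + h *\<^sub>R axis j 1) + s *\<^sub>R axis i 1) - f (x + s *\<^sub>R axis i 1)"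
  have "\<exists>z>0. z < h \<and> ?g h - ?g 0 = (h - 0) *
      (pd i f ((x + h *\<^sub>R axis j 1) + z *\<^sub>R axis i 1) - pd i f (x + z *\<^sub>R axis i 1))"
    by (rule MVT2[OF h]) (intro DERIV_diff smooth_line_derivative f)
  then obtain \<xi> where \<xi>: "0 < \<xi>" "\<xi> < h" "?g h - ?g 0 = h *
      (pd i f ((x + \<xi> *\<^sub>R axis i 1) + h *\<^sub>R axis j 1) - pd i f (x + \<xi> *\<^sub>R axis i 1))"
    by (auto simp: ac_simps)
  obtain \<eta> where "0 < \<eta>" "\<eta> < h"
    "pd i f ((x + \<xi> *\<^sub>R axis i 1) + h *\<^sub>R axis j 1) - pd i f (x + \<xi> *\<^sub>R axis i 1)
      = h * pd j (pd i f) (x + \<xi> *\<^sub>R axis i 1 + \<eta> *\<^sub>R axis j 1)"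
    using smooth_mvt[OF smooth_pd[OF f] h] by metis
  with \<xi> show ?thesis
    by (intro that[of \<xi> \<eta>]) (auto simp: power2_eq_square algebra_simps)
qed

text \<open>The second difference is symmetric in the two directions, while the mean value form
  identifies the limit of its quotient by the squared step as either mixed derivative.\<close>

lemma pd_commute:
  assumes f: "smooth f"
  shows "pd i (pd j f) x = pd j (pd i f) x"
proof -
  define e :: "nat \<Rightarrow> real" where "e n = 1 / Suc n" for n
  have e: "e n > 0" for n by (simp add: e_def)
  have e0: "e \<longlonglongrightarrow> 0" unfolding e_def using LIMSEQ_inverse_real_of_nat by (simp add: inverse_eq_divide)
  define Q where "Q n = (f (x + e n *\<^sub>R axis i 1 + e n *\<^sub>R axis j 1) - f (x + e n *\<^sub>R axis i 1)
      - f (x + e n *\<^sub>R axis j 1) + f x) / (e n)\<^sup>2" for n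
  \<comment> \<open>The indices are generalised again here, so that the same fact serves for both
    orders of differentiation.\<close>
  have lim: "Q' \<longlonglongrightarrow> pd j (pd i f) x"
    if Q': "\<And>n. Q' n = (f (x + e n *\<^sub>R axis i 1 + e n *\<^sub>R axis j 1) - f (x + e n *\<^sub>R axis i 1)
      - f (x + e n *\<^sub>R axis j 1) + f x) / (e n)\<^sup>2" for i j and Q' :: "nat \<Rightarrow> real"
  proof -
    have "\<exists>\<xi> \<eta>. 0 < \<xi> \<and> \<xi> < e n \<and> 0 < \<eta> \<and> \<eta> < e n \<and>
        Q' n = pd j (pd i f) (x + \<xi> *\<^sub>R axis i 1 + \<eta> *\<^sub>R axis j 1)" for n
      unfolding Q' by (rule smooth_second_difference[OF f e[of n], of x i j]) (use e[of n] in auto)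
    then obtain \<xi> \<eta> where *: "\<And>n. 0 < \<xi> n \<and> \<xi> n < e n \<and> 0 < \<eta> n \<and> \<eta> n < e n \<and>
        Q' n = pd j (pd i f) (x + \<xi> n *\<^sub>R axis i 1 + \<eta> n *\<^sub>R axis j 1)"
      by metis
    have "\<xi> \<longlonglongrightarrow> 0" "\<eta> \<longlonglongrightarrow> 0"
      by (rule tendsto_sandwich[OF _ _ tendsto_const e0]; use * in \<open>auto intro!: always_eventually less_imp_le\<close>)+
    then have "(\<lambda>n. x + \<xi> n *\<^sub>R axis i 1 + \<eta> n *\<^sub>R axis j 1) \<longlonglongrightarrow> x + 0 *\<^sub>R axis i 1 + 0 *\<^sub>R axis j 1"
      by (intro tendsto_intros)
    moreover have "isCont (pd j (pd i f)) x"
      using smooth_continuous[OF smooth_pd[OF smooth_pd[OF f]], of UNIV] continuous_on_eq_continuous_at by blast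
    moreover have "Q' = (\<lambda>n. pd j (pd i f) (x + \<xi> n *\<^sub>R axis i 1 + \<eta> n *\<^sub>R axis j 1))"
      using * by auto
    ultimately show ?thesis
      using isCont_tendsto_compose[of x "pd j (pd i f)"] by simp
  qed
  have "Q \<longlonglongrightarrow> pd j (pd i f) x" by (rule lim) (simp add: Q_def)
  moreover have "Q \<longlonglongrightarrow> pd i (pd j f) x" by (rule lim) (simp add: Q_def algebra_simps)
  ultimately show ?thesis using LIMSEQ_unique by blast
qed

section \<open>Integrals of derivatives of test functions\<close>

lemma integral_vol_borel:
  fixes f :: "real^2 \<Rightarrow> 'a::{banach, second_countable_topology}"
  assumes "S \<in> sets borel" "f \<in> borel_measurable borel"
  shows "integral\<^sup>L (lebesgue_on S) f = integral\<^sup>L lborel (\<lambda>x. indicator S x *\<^sub>R f x)"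
proof -
  note assms[measurable]
  have "integral\<^sup>L (lebesgue_on S) f = integral\<^sup>L lebesgue (\<lambda>x. indicator S x *\<^sub>R f x)"
    using assms by (intro integral_restrict_space) auto
  also have "\<dots> = integral\<^sup>L lborel (\<lambda>x. indicator S x *\<^sub>R f x)"
    by (intro integral_completion) measurable
  finally show ?thesis .
qed

lemma integral_lborel_translate:
  fixes f :: "'a::euclidean_space \<Rightarrow> real"
  assumes "f \<in> borel_measurable borel"
  shows "integral\<^sup>L lborel (\<lambda>x. f (x + c)) = integral\<^sup>L lborel f"
proof -
  have "integral\<^sup>L lborel f = integral\<^sup>L (distr lborel borel ((+) c)) f"
    by (simp add: lborel_distr_plus)
  also have "\<dots> = integral\<^sup>L lborel (\<lambda>x. f (c + x))"
    using assms by (intro integral_distr) auto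
  finally show ?thesis by (simp add: add.commute)
qed

text \<open>Invariance under small translations makes the integrals of all difference quotients
  vanish, and dominated convergence passes to the derivative. No iterated integrals or boundary
  terms enter.\<close>

lemma integral_pd_eq_0:
  assumes f: "smooth f" and S: "S \<in> sets borel" "bounded S" and "\<epsilon> > 0"
    and inv: "\<And>h. 0 < h \<Longrightarrow> h < \<epsilon> \<Longrightarrow>
      integral\<^sup>L lborel (\<lambda>x. indicator S x * f (x + h *\<^sub>R axis i 1)) = integral\<^sup>L lborel (\<lambda>x. indicator S x * f x)"
  shows "integral\<^sup>L lborel (\<lambda>x. indicator S x * pd i f x) = 0"
proof -
  obtain R where R: "\<And>x. x \<in> S \<Longrightarrow> norm x \<le> R" using S(2) bounded_iff by blast
  \<comment> \<open>The ball of radius \<open>R + \<epsilon>\<close> contains all intermediate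
    points \<open>x + \<xi> e_i\<close> with \<open>x\<close> in \<open>S\<close>, so by the mean
    value theorem \<open>C\<close> dominates the difference quotients.\<close>
  have "bounded (pd i f ` cball 0 (R + \<epsilon>))"
    by (intro compact_imp_bounded compact_continuous_image smooth_continuous smooth_pd f compact_cball)
  then obtain C where C: "\<And>x. norm x \<le> R + \<epsilon> \<Longrightarrow> \<bar>pd i f x\<bar> \<le> C"
    unfolding bounded_iff by (metis imageI mem_cball_0 real_norm_def)
  \<comment> \<open>The summand 2 keeps every step strictly below \<open>\<epsilon>\<close>, also at
    \<open>n = 0\<close>.\<close>
  define h where "h n = \<epsilon> / (real n + 2)" for n
  have h: "0 < h n" "h n < \<epsilon>" for n
    using \<open>\<epsilon> > 0\<close> by (auto simp: h_def divide_simps algebra_simps add_pos_nonneg)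
  have h0: "h \<longlonglongrightarrow> 0"
    unfolding h_def by (intro tendsto_divide_0[OF tendsto_const] filterlim_at_top_imp_at_infinity filterlim_tendsto_add_at_top[OF tendsto_const, of _ _ 2, unfolded add.commute[of 2]] filterlim_real_sequentially)
  have [measurable]: "f \<in> borel_measurable borel" "pd i f \<in> borel_measurable borel"
    by (auto intro!: borel_measurable_continuous_onI smooth_continuous smooth_pd f)
  note S(1)[measurable]
  let ?q = "\<lambda>n x. indicator S x * ((f (x + h n *\<^sub>R axis i 1) - f x) / h n)"
  have fin: "emeasure lborel S < \<infinity>" by (rule emeasure_bounded_finite[OF S(2)])
  have fb: "\<exists>M. \<forall>x\<in>S. \<bar>f (x + s *\<^sub>R axis i 1)\<bar> \<le> M" if "\<bar>s\<bar> \<le> \<epsilon>" for s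
  proof -
    have "bounded (f ` cball 0 (R + \<epsilon>))"
      by (intro compact_imp_bounded compact_continuous_image smooth_continuous f compact_cball)
    moreover have "x + s *\<^sub>R axis i 1 \<in> cball 0 (R + \<epsilon>)" if "x \<in> S" for x
      using R[OF that] \<open>\<bar>s\<bar> \<le> \<epsilon>\<close> norm_triangle_ineq[of x "s *\<^sub>R axis i 1"] by simp
    ultimately show ?thesis unfolding bounded_iff by fastforce
  qed
  have int: "integrable lborel (\<lambda>x. indicator S x * f (x + s *\<^sub>R axis i 1))" if "\<bar>s\<bar> \<le> \<epsilon>" for s
  proof -
    obtain M where "\<forall>x\<in>S. \<bar>f (x + s *\<^sub>R axis i 1)\<bar> \<le> M" using fb[OF \<open>\<bar>s\<bar> \<le> \<epsilon>\<close>] by blast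
    then show ?thesis
      by (intro integrableI_bounded_set[of S _ _ M]) (use fin in \<open>auto simp: indicator_def\<close>)
  qed
  have q0: "integral\<^sup>L lborel (?q n) = 0" for n
  proof -
    have "?q n = (\<lambda>x. (indicator S x * f (x + h n *\<^sub>R axis i 1) - indicator S x * f x) / h n)"
      by (auto simp: fun_eq_iff algebra_simps diff_divide_distrib)
    then show ?thesis
      using inv[OF h] int[of "h n"] int[of 0] h[of n] by simp
  qed
  have "(\<lambda>n. integral\<^sup>L lborel (?q n)) \<longlonglongrightarrow> integral\<^sup>L lborel (\<lambda>x. indicator S x * pd i f x)"
  proof (rule integral_dominated_convergence[where w = "\<lambda>x. C * indicator S x"])
    show "AE x in lborel. (\<lambda>n. ?q n x) \<longlonglongrightarrow> indicator S x * pd i f x"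
    proof (rule AE_I2, intro tendsto_mult tendsto_const)
      fix x
      have "((\<lambda>s. (f (x + s *\<^sub>R axis i 1) - f x) / s) \<longlongrightarrow> pd i f x) (at 0)"
        using smooth_line_derivative[OF f, of x i 0] by (simp add: has_field_derivative_iff)
      then show "(\<lambda>n. (f (x + h n *\<^sub>R axis i 1) - f x) / h n) \<longlonglongrightarrow> pd i f x"
        by (rule tendsto_compose_eventually[OF _ h0])
           (use h in \<open>auto intro!: always_eventually simp: less_imp_neq[symmetric]\<close>)
    qed
    show "AE x in lborel. norm (?q n x) \<le> C * indicator S x" for n
    proof (rule AE_I2)
      fix x
      show "norm (?q n x) \<le> C * indicator S x"
      proof (cases "x \<in> S")
        case True
        obtain \<xi> where \<xi>: "0 < \<xi>" "\<xi> < h n" "f (x + h n *\<^sub>R axis i 1) - f x = h n * pd i f (x + \<xi> *\<^sub>R axis i 1)"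
          using smooth_mvt[OF f h(1)] by metis
        have "norm (x + \<xi> *\<^sub>R axis i 1) \<le> R + \<epsilon>"
          using R[OF True] \<xi> h[of n] norm_triangle_ineq[of x "\<xi> *\<^sub>R axis i 1"] by simp
        from C[OF this] show ?thesis using True \<xi> h[of n] by simp
      qed simp
    qed
  qed (use fin in auto)
  then show ?thesis
    by (simp only: q0 LIMSEQ_const_iff)
qed

lemma axis_eq_scaleR: "axis i (c::real) = c *\<^sub>R axis i 1"
  by (simp add: vec_eq_iff axis_def)

text \<open>The shifted cell loses the slab between \<open>a $ i\<close> and
  \<open>a $ i + h\<close> and gains the one between \<open>b $ i\<close> and
  \<open>b $ i + h\<close>; periodicity gives both the same integral.\<close>

lemma periodic_cell_shift:
  fixes f :: "real^2 \<Rightarrow> real"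
  assumes [measurable]: "f \<in> borel_measurable borel"
    and bnd: "\<And>S. bounded S \<Longrightarrow> bounded (f ` S)"
    and per: "\<And>x. f (x + axis i (b $ i - a $ i)) = f x"
    and h: "0 < h" "h < b $ i - a $ i"
  shows "integral\<^sup>L lborel (\<lambda>x. indicator (box a b) x * f (x + h *\<^sub>R axis i 1))
       = integral\<^sup>L lborel (\<lambda>x. indicator (box a b) x * f x)"
proof -
  \<comment> \<open>Half-open slabs tile without overlap, so \<open>I\<close> is exactly additive;
    the open cell differs from its slab by a null set only.\<close>
  define sl where "sl \<alpha> \<beta> = {x::real^2. (\<alpha> \<le> x $ i \<and> x $ i < \<beta>) \<and> (\<forall>j. j \<noteq> i \<longrightarrow> a $ j \<le> x $ j \<and> x $ j < b $ j)}" for \<alpha> \<beta>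
  have vn[measurable]: "(\<lambda>x::real^2. x $ j) \<in> borel_measurable borel" for j
    by (intro borel_measurable_continuous_onI continuous_intros)
  have [measurable]: "sl \<alpha> \<beta> \<in> sets borel" for \<alpha> \<beta>
    unfolding sl_def by measurable
  have slb: "bounded (sl \<alpha> \<beta>)" for \<alpha> \<beta>
  proof (rule bounded_subset[OF bounded_cbox])
    show "sl \<alpha> \<beta> \<subseteq> cbox (\<chi> j. if j = i then \<alpha> else a $ j) (\<chi> j. if j = i then \<beta> else b $ j)"
    proof
      fix x assume x: "x \<in> sl \<alpha> \<beta>"
      have "(if j = i then \<alpha> else a $ j) \<le> x $ j \<and> x $ j \<le> (if j = i then \<beta> else b $ j)" for j
        using x by (cases "j = i") (auto simp: sl_def less_imp_le)
      then show "x \<in> cbox (\<chi> j. if j = i then \<alpha> else a $ j) (\<chi> j. if j = i then \<beta> else b $ j)"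
        by (simp add: mem_box_cart)
    qed
  qed
  define I where "I \<alpha> \<beta> = integral\<^sup>L lborel (\<lambda>x. indicator (sl \<alpha> \<beta>) x * f x)" for \<alpha> \<beta>
  have int: "integrable lborel (\<lambda>x. indicator (sl \<alpha> \<beta>) x * f x)" for \<alpha> \<beta>
  proof -
    obtain M where "\<And>x. x \<in> sl \<alpha> \<beta> \<Longrightarrow> \<bar>f x\<bar> \<le> M"
      using bnd[OF slb] unfolding bounded_iff by fastforce
    then show ?thesis
      by (intro integrableI_bounded_set[of "sl \<alpha> \<beta>" _ _ M])
         (use emeasure_bounded_finite[OF slb] in \<open>auto simp: indicator_def\<close>)
  qed
  have add: "I \<alpha> \<gamma> = I \<alpha> \<beta> + I \<beta> \<gamma>" if "\<alpha> \<le> \<beta>" "\<beta> \<le> \<gamma>" for \<alpha> \<beta> \<gamma>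
    unfolding I_def
    by (subst Bochner_Integration.integral_add[symmetric, OF int int])
       (use that in \<open>auto intro!: Bochner_Integration.integral_cong simp: indicator_def sl_def\<close>)
  have shift: "I (\<alpha> + s) (\<beta> + s) = integral\<^sup>L lborel (\<lambda>x. indicator (sl \<alpha> \<beta>) x * f (x + s *\<^sub>R axis i 1))" for \<alpha> \<beta> s
  proof -
    have "I (\<alpha> + s) (\<beta> + s) = integral\<^sup>L lborel (\<lambda>x. indicator (sl (\<alpha> + s) (\<beta> + s)) (x + s *\<^sub>R axis i 1) * f (x + s *\<^sub>R axis i 1))"
      unfolding I_def by (rule integral_lborel_translate[symmetric]) measurable
    also have "(\<lambda>x. indicator (sl (\<alpha> + s) (\<beta> + s)) (x + s *\<^sub>R axis i 1) :: real) = indicator (sl \<alpha> \<beta>)"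
      by (auto simp: fun_eq_iff sl_def indicator_def axis_def)
    finally show ?thesis .
  qed
  have per': "I (\<alpha> + (b $ i - a $ i)) (\<beta> + (b $ i - a $ i)) = I \<alpha> \<beta>" for \<alpha> \<beta>
    unfolding shift using per by (simp add: axis_eq_scaleR[of i "b $ i - a $ i"] I_def)
  have ae: "AE x in lborel. (indicator (box a b) x :: real) = indicator (sl (a $ i) (b $ i)) x"
  proof -
    have "cbox a b - box a b \<in> null_sets lborel"
      using negligible_frontier_interval[of a b] by (simp add: negligible_iff_null_sets null_sets_completion_iff)
    then show ?thesis
    proof (rule AE_I'[of "cbox a b - box a b"], safe)
      fix x assume *: "(indicator (box a b) x :: real) \<noteq> indicator (sl (a $ i) (b $ i)) x"
      have "box a b \<subseteq> sl (a $ i) (b $ i)" "sl (a $ i) (b $ i) \<subseteq> cbox a b"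
        by (auto simp: sl_def mem_box_cart less_imp_le) (metis less_imp_le)+
      with * show "x \<in> cbox a b" "x \<in> box a b \<Longrightarrow> False"
        by (auto simp: indicator_def of_bool_def split: if_splits)
    qed
  qed
  have "integral\<^sup>L lborel (\<lambda>x. indicator (box a b) x * f (x + h *\<^sub>R axis i 1)) =
      integral\<^sup>L lborel (\<lambda>x. indicator (sl (a $ i) (b $ i)) x * f (x + h *\<^sub>R axis i 1))"
    by (intro integral_cong_AE) (use ae in auto)
  also have "\<dots> = I (a $ i + h) (b $ i + h)" by (rule shift[symmetric])
  also have "\<dots> = I (a $ i + h) (b $ i) + I (b $ i) (b $ i + h)" using h by (intro add) auto
  also have "I (b $ i) (b $ i + h) = I (a $ i) (a $ i + h)" using per'[of "a $ i" "a $ i + h"] by (simp add: add.commute)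
  also have "I (a $ i + h) (b $ i) + I (a $ i) (a $ i + h) = I (a $ i) (b $ i)"
    using h add[of "a $ i" "a $ i + h" "b $ i"] by simp
  also have "\<dots> = integral\<^sup>L lborel (\<lambda>x. indicator (box a b) x * f x)"
    unfolding I_def by (intro integral_cong_AE) (use ae in auto)
  finally show ?thesis .
qed

lemma region_open: "admissible_domain D \<Longrightarrow> open (region D)"
  by (cases D) (auto simp: lipschitz_domain_def)

lemma region_bounded: "admissible_domain D \<Longrightarrow> bounded (region D)"
  by (cases D) auto

lemma region_sets: "admissible_domain D \<Longrightarrow> region D \<in> sets borel"
  using region_open by auto

lemma finite_measure_vol: "admissible_domain D \<Longrightarrow> finite_measure (vol D)"
  by (intro finite_measureI)
     (use emeasure_bounded_finite[OF region_bounded] region_sets in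
       \<open>fastforce simp: emeasure_restrict_space space_restrict_space\<close>)

lemma test_smooth: "\<phi> \<in> test_functions D \<Longrightarrow> smooth \<phi>"
  by (cases D) auto

lemma pd_eq_0_outside_support:
  assumes "compact K" "\<And>x. x \<notin> K \<Longrightarrow> f x = 0" "x \<notin> K"
  shows "pd i f x = 0"
proof -
  have "(f has_derivative (\<lambda>h. 0)) (at x)"
    by (rule has_derivative_transform_within_open[of "\<lambda>x. 0" _ _ UNIV "- K"])
       (use assms in \<open>auto simp: compact_imp_closed open_Compl\<close>)
  then show ?thesis by (rule pd_eqI)
qed

lemma test_pd:
  assumes "\<phi> \<in> test_functions D"
  shows "pd i \<phi> \<in> test_functions D"
proof (cases D)
  case (Periodic a b)
  have "pd i \<phi> (x + axis j (b $ j - a $ j)) = pd i \<phi> x" for j x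
  proof -
    let ?c = "axis j (b $ j - a $ j) :: real^2"
    have "(\<phi> has_derivative frechet_derivative \<phi> (at (x + ?c))) (at (x + ?c))"
      using smooth_differentiable[OF test_smooth[OF assms]] frechet_derivative_works by blast
    then have "((\<lambda>y. \<phi> (y + ?c)) has_derivative frechet_derivative \<phi> (at (x + ?c))) (at x)"
      by (rule has_derivative_compose[rotated]) (auto intro!: derivative_eq_intros)
    moreover have "(\<lambda>y. \<phi> (y + ?c)) = \<phi>" using assms Periodic by auto
    ultimately show ?thesis using pd_eqI[of \<phi> _ x i] by (simp add: pd_def[of _ _ "x + ?c"])
  qed
  then show ?thesis using assms Periodic by (auto intro!: smooth_pd)
next
  case (Homogeneous W)
  then obtain K where "compact K" "K \<subseteq> W" "\<And>x. x \<notin> K \<Longrightarrow> \<phi> x = 0" using assms by auto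
  moreover from this have "\<And>x. x \<notin> K \<Longrightarrow> pd i \<phi> x = 0"
    using pd_eq_0_outside_support[of K \<phi>] by blast
  ultimately show ?thesis using assms Homogeneous by (auto intro!: smooth_pd)
qed

lemma test_add:
  assumes "\<phi> \<in> test_functions D" "\<psi> \<in> test_functions D"
  shows "(\<lambda>x. \<phi> x + \<psi> x) \<in> test_functions D"
proof (cases D)
  case (Homogeneous W)
  with assms obtain K K' where "compact K" "K \<subseteq> W" "\<forall>x. x \<notin> K \<longrightarrow> \<phi> x = 0"
    "compact K'" "K' \<subseteq> W" "\<forall>x. x \<notin> K' \<longrightarrow> \<psi> x = 0" by auto
  then have "compact (K \<union> K') \<and> K \<union> K' \<subseteq> W \<and> (\<forall>x. x \<notin> K \<union> K' \<longrightarrow> \<phi> x + \<psi> x = 0)"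
    by auto
  then show ?thesis using assms Homogeneous by (auto intro!: smooth_add)
qed (use assms in \<open>auto intro!: smooth_add\<close>)

text \<open>On a periodic cell this is the shift invariance above. For compact support, the domain
  can be exchanged for a ball around the support, where small translations change nothing. In
  particular constant fields have weak divergence zero.\<close>

lemma integral_test_pd:
  assumes D: "admissible_domain D" and \<phi>: "\<phi> \<in> test_functions D"
  shows "(LINT x|vol D. pd i \<phi> x) = 0"
proof -
  note s = test_smooth[OF \<phi>]
  have [measurable]: "\<phi> \<in> borel_measurable borel" "pd i \<phi> \<in> borel_measurable borel"
    by (auto intro!: borel_measurable_continuous_onI smooth_continuous smooth_pd s)
  have bnd: "bounded (\<phi> ` S)" if "bounded S" for S
  proof -
    have "bounded (\<phi> ` closure S)"
      using that by (intro compact_imp_bounded compact_continuous_image smooth_continuous s) auto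
    then show ?thesis using bounded_subset closure_subset by (metis image_mono)
  qed
  have "(LINT x|vol D. pd i \<phi> x) = integral\<^sup>L lborel (\<lambda>x. indicator (region D) x * pd i \<phi> x)"
    using integral_vol_borel[OF region_sets[OF D], of "pd i \<phi>"] by simp
  also have "\<dots> = 0"
  proof (cases D)
    case (Periodic a b)
    show ?thesis
      unfolding Periodic region.simps
    proof (rule integral_pd_eq_0[OF s, where \<epsilon> = "b $ i - a $ i"])
      show "integral\<^sup>L lborel (\<lambda>x. indicator (box a b) x * \<phi> (x + h *\<^sub>R axis i 1)) =
          integral\<^sup>L lborel (\<lambda>x. indicator (box a b) x * \<phi> x)" if "0 < h" "h < b $ i - a $ i" for h
        by (rule periodic_cell_shift[OF _ bnd _ that]) (use Periodic \<phi> in auto)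
    qed (use D Periodic in auto)
  next
    case (Homogeneous W)
    then obtain K where K: "compact K" "K \<subseteq> W" "\<And>x. x \<notin> K \<Longrightarrow> \<phi> x = 0" using \<phi> by auto
    obtain R where R: "\<And>x. x \<in> K \<Longrightarrow> norm x < R"
      using compact_imp_bounded[OF K(1)] unfolding bounded_pos_less by blast
    \<comment> \<open>The margin 1 keeps the support inside the ball under every translation shorter
      than 1.\<close>
    let ?B = "ball 0 (R + 1) :: (real^2) set"
    have "integral\<^sup>L lborel (\<lambda>x. indicator (region D) x * pd i \<phi> x) =
        integral\<^sup>L lborel (\<lambda>x. indicator ?B x * pd i \<phi> x)"
    proof (rule Bochner_Integration.integral_cong[OF refl])
      fix x
      show "indicator (region D) x * pd i \<phi> x = indicator ?B x * pd i \<phi> x"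
        using pd_eq_0_outside_support[where f = \<phi> and x = x and i = i, OF K(1,3)] K(2) R[of x] Homogeneous
        by (cases "x \<in> K") (auto simp: indicator_def)
    qed
    also have "\<dots> = 0"
    proof (rule integral_pd_eq_0[OF s, where \<epsilon> = 1])
      fix h :: real assume h: "0 < h" "h < 1"
      have "indicator ?B x * \<phi> (x + s *\<^sub>R axis i 1) = \<phi> (x + s *\<^sub>R axis i 1)" if "0 \<le> s" "s < 1" for x s
      proof (cases "x + s *\<^sub>R axis i 1 \<in> K")
        case True
        have "norm x \<le> norm (x + s *\<^sub>R axis i 1) + norm (s *\<^sub>R axis i 1 :: real^2)"
          using norm_triangle_ineq4[of "x + s *\<^sub>R axis i 1" "s *\<^sub>R axis i 1"] by simp
        then have "norm x < R + 1" using R[OF True] that by simp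
        then show ?thesis by simp
      qed (simp add: K(3))
      then have "(\<lambda>x. indicator ?B x * \<phi> (x + s *\<^sub>R axis i 1)) = (\<lambda>x. \<phi> (x + s *\<^sub>R axis i 1))" if "0 \<le> s" "s < 1" for s
        using that by blast
      from this[of 0] this[of h] h show "integral\<^sup>L lborel (\<lambda>x. indicator ?B x * \<phi> (x + h *\<^sub>R axis i 1)) =
          integral\<^sup>L lborel (\<lambda>x. indicator ?B x * \<phi> x)"
        using integral_lborel_translate[of \<phi> "h *\<^sub>R axis i 1"] by simp
    qed auto
    finally show ?thesis .
  qed
  finally show ?thesis .
qed

section \<open>Square integrable functions\<close>

lemma bounded_in_L2:
  fixes f :: "real^2 \<Rightarrow> 'a::euclidean_space"
  assumes D: "admissible_domain D" and f: "f \<in> borel_measurable (vol D)"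
    and "\<And>x. x \<in> region D \<Longrightarrow> norm (f x) \<le> C"
  shows "f \<in> L2 D"
proof -
  interpret finite_measure "vol D" by (rule finite_measure_vol[OF D])
  have "integrable (vol D) (\<lambda>x. (norm (f x))\<^sup>2)"
    by (rule integrable_const_bound[where B = "C\<^sup>2"])
       (use f assms(3) in \<open>auto simp: space_restrict_space intro!: AE_I2 power_mono\<close>)
  then show ?thesis using f by (simp add: L2_def)
qed

lemma continuous_in_L2:
  fixes f :: "real^2 \<Rightarrow> 'a::euclidean_space"
  assumes D: "admissible_domain D" and f: "continuous_on UNIV f"
  shows "f \<in> L2 D"
proof -
  have "bounded (f ` closure (region D))"
    by (intro compact_imp_bounded compact_continuous_image)
       (use f region_bounded[OF D] continuous_on_subset in auto)
  then obtain C where "\<And>x. x \<in> closure (region D) \<Longrightarrow> norm (f x) \<le> C"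
    unfolding bounded_iff by blast
  moreover have "f \<in> borel_measurable (vol D)"
    using borel_measurable_continuous_onI[OF f]
    by (intro measurable_restrict_space1 measurable_completion) simp
  ultimately show ?thesis
    using bounded_in_L2[OF D] closure_subset by (metis subsetD)
qed

lemma test_function_in_L2:
  "admissible_domain D \<Longrightarrow> \<phi> \<in> test_functions D \<Longrightarrow> \<phi> \<in> L2 D"
  by (intro continuous_in_L2 smooth_continuous test_smooth)

lemma grad_test_in_L2:
  assumes "admissible_domain D" "\<phi> \<in> test_functions D"
  shows "grad \<phi> \<in> L2 D"
  unfolding grad_def
  by (intro continuous_in_L2 assms continuous_on_vec_lambda smooth_continuous smooth_pd test_smooth[OF assms(2)])

lemma L2_measurable: "f \<in> L2 D \<Longrightarrow> f \<in> borel_measurable (vol D)"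
  by (simp add: L2_def)

lemma L2_square_integrable: "f \<in> L2 D \<Longrightarrow> integrable (vol D) (\<lambda>x. (norm (f x))\<^sup>2)"
  by (simp add: L2_def)

lemma L2_inner_integrable:
  assumes "f \<in> L2 D" "g \<in> L2 D"
  shows "integrable (vol D) (\<lambda>x. f x \<bullet> g x)"
proof (rule Bochner_Integration.integrable_bound)
  show "integrable (vol D) (\<lambda>x. (norm (f x))\<^sup>2 + (norm (g x))\<^sup>2)"
    using assms by (intro Bochner_Integration.integrable_add L2_square_integrable)
  show "(\<lambda>x. f x \<bullet> g x) \<in> borel_measurable (vol D)"
    using assms[THEN L2_measurable] by measurable
  show "AE x in vol D. norm (f x \<bullet> g x) \<le> norm ((norm (f x))\<^sup>2 + (norm (g x))\<^sup>2)"
  proof (rule AE_I2)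
    fix x
    have "\<bar>f x \<bullet> g x\<bar> \<le> norm (f x) * norm (g x)" by (rule Cauchy_Schwarz_ineq2)
    also have "2 * (norm (f x) * norm (g x)) \<le> (norm (f x))\<^sup>2 + (norm (g x))\<^sup>2"
      using sum_squares_bound[of "norm (f x)" "norm (g x)"] by (simp add: mult.assoc)
    then have "norm (f x) * norm (g x) \<le> (norm (f x))\<^sup>2 + (norm (g x))\<^sup>2"
      using mult_nonneg_nonneg[OF norm_ge_zero[of "f x"] norm_ge_zero[of "g x"]] by linarith
    finally show "norm (f x \<bullet> g x) \<le> norm ((norm (f x))\<^sup>2 + (norm (g x))\<^sup>2)" by simp
  qed
qed

lemma L2_mult_integrable:
  fixes f g :: "real^2 \<Rightarrow> real"
  shows "f \<in> L2 D \<Longrightarrow> g \<in> L2 D \<Longrightarrow> integrable (vol D) (\<lambda>x. f x * g x)"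
  using L2_inner_integrable[of f D g] by simp

lemma L2_scaleR: "f \<in> L2 D \<Longrightarrow> (\<lambda>x. c *\<^sub>R f x) \<in> L2 D"
  by (auto simp: L2_def power_mult_distrib)

lemma L2_add:
  assumes "f \<in> L2 D" "g \<in> L2 D"
  shows "(\<lambda>x. f x + g x) \<in> L2 D"
proof -
  have "integrable (vol D) (\<lambda>x. (norm (f x))\<^sup>2 + 2 * (f x \<bullet> g x) + (norm (g x))\<^sup>2)"
    using assms by (intro Bochner_Integration.integrable_add L2_square_integrable integrable_mult_right L2_inner_integrable)
  moreover have "(norm (f x + g x))\<^sup>2 = (norm (f x))\<^sup>2 + 2 * (f x \<bullet> g x) + (norm (g x))\<^sup>2" for x
    by (simp add: power2_norm_eq_inner inner_simps inner_commute)
  ultimately show ?thesis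
    using assms[THEN L2_measurable] by (auto simp: L2_def)
qed

lemma L2_diff: "f \<in> L2 D \<Longrightarrow> g \<in> L2 D \<Longrightarrow> (\<lambda>x. f x - g x) \<in> L2 D"
  using L2_add[of f D "\<lambda>x. -1 *\<^sub>R g x"] L2_scaleR[of g D "-1"] by simp

lemma L2_component:
  fixes v :: "real^2 \<Rightarrow> real^2"
  assumes "v \<in> L2 D"
  shows "(\<lambda>x. v x $ i) \<in> L2 D"
proof -
  note [measurable] = L2_measurable[OF assms]
  have "(\<lambda>x. v x \<bullet> axis i 1) \<in> borel_measurable (vol D)" by measurable
  then have m: "(\<lambda>x. v x $ i) \<in> borel_measurable (vol D)" by (simp add: inner_axis)
  have "integrable (vol D) (\<lambda>x. (norm (v x $ i))\<^sup>2)"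
    by (rule Bochner_Integration.integrable_bound[OF L2_square_integrable[OF assms]])
       (use m in \<open>auto intro!: AE_I2 power_mono simp: component_le_norm_cart abs_le_square_iff[symmetric]\<close>)
  then show ?thesis using m by (simp add: L2_def)
qed

lemma L2_inner_self_0:
  assumes "f \<in> L2 D" "(LINT x|vol D. f x \<bullet> f x) = 0"
  shows "AE x in vol D. f x = 0"
  using integral_nonneg_eq_0_iff_AE[OF L2_inner_integrable[OF assms(1,1)]] assms(2) by simp

text \<open>The squared norm of \<open>f - s g\<close> is a quadratic polynomial in \<open>s\<close>
  that is nowhere negative.\<close>

lemma L2_norm_Cauchy_Schwarz:
  assumes "f \<in> L2 D" "g \<in> L2 D"
  shows "\<bar>LINT x|vol D. f x \<bullet> g x\<bar> \<le> L2_norm D f * L2_norm D g"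
proof -
  let ?A = "LINT x|vol D. (norm (f x))\<^sup>2" and ?B = "LINT x|vol D. (norm (g x))\<^sup>2"
    and ?I = "LINT x|vol D. f x \<bullet> g x"
  have "0 \<le> ?A - 2 * s * ?I + s\<^sup>2 * ?B" for s
  proof -
    have "0 \<le> (LINT x|vol D. (norm (f x - s *\<^sub>R g x))\<^sup>2)" by (rule integral_nonneg_AE) simp
    also have "\<dots> = (LINT x|vol D. (norm (f x))\<^sup>2 - 2 * s * (f x \<bullet> g x) + s\<^sup>2 * (norm (g x))\<^sup>2)"
      by (intro Bochner_Integration.integral_cong refl)
         (simp add: power2_norm_eq_inner inner_simps inner_commute power2_eq_square[of s] algebra_simps)
    also have "\<dots> = ?A - 2 * s * ?I + s\<^sup>2 * ?B"
      using L2_square_integrable[OF assms(1)] L2_square_integrable[OF assms(2)] L2_inner_integrable[OF assms] by simp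
    finally show ?thesis .
  qed
  note pos = this
  have "?I\<^sup>2 \<le> ?A * ?B"
  proof (cases "?B = 0")
    case True
    have "?I = 0"
    proof (rule ccontr)
      assume "?I \<noteq> 0"
      \<comment> \<open>With \<open>?B = 0\<close> the polynomial is affine in \<open>s\<close>, and
        at this \<open>s\<close> it takes the value -1.\<close>
      with pos[of "(?A + 1) / (2 * ?I)"] True show False by (simp add: field_simps)
    qed
    then show ?thesis using True by simp
  next
    case False
    moreover have "0 \<le> ?B" by (rule integral_nonneg_AE) simp
    ultimately have "?B > 0" by linarith
    \<comment> \<open>The minimiser of the quadratic.\<close>
    with pos[of "?I / ?B"] show ?thesis by (simp add: field_simps power2_eq_square)
  qed
  then have "sqrt (?I\<^sup>2) \<le> sqrt (?A * ?B)" by (rule real_sqrt_le_mono)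
  then show ?thesis by (simp add: L2_norm_def real_sqrt_mult)
qed

lemma L2_inner_tendsto_0:
  assumes "eventually (\<lambda>s. f s \<in> L2 D) F" "g \<in> L2 D" "((\<lambda>s. L2_norm D (f s)) \<longlongrightarrow> 0) F"
  shows "((\<lambda>s. LINT x|vol D. f s x \<bullet> g x) \<longlongrightarrow> 0) F"
proof (rule tendsto_rabs_zero_cancel, rule tendsto_sandwich[OF _ _ tendsto_const])
  show "((\<lambda>s. L2_norm D (f s) * L2_norm D g) \<longlongrightarrow> 0) F"
    using tendsto_mult[OF assms(3) tendsto_const] by simp
  show "eventually (\<lambda>s. \<bar>LINT x|vol D. f s x \<bullet> g x\<bar> \<le> L2_norm D (f s) * L2_norm D g) F"
    using assms(1) by eventually_elim (rule L2_norm_Cauchy_Schwarz[OF _ assms(2)])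
qed simp

lemma L2_inner_tendsto:
  assumes "\<And>s. f s \<in> L2 D" "h \<in> L2 D" "g \<in> L2 D" "((\<lambda>s. L2_norm D (\<lambda>x. f s x - h x)) \<longlongrightarrow> 0) F"
  shows "((\<lambda>s. LINT x|vol D. f s x \<bullet> g x) \<longlongrightarrow> (LINT x|vol D. h x \<bullet> g x)) F"
proof -
  have "((\<lambda>s. LINT x|vol D. (f s x - h x) \<bullet> g x) \<longlongrightarrow> 0) F"
    by (rule L2_inner_tendsto_0) (use assms in \<open>auto intro!: always_eventually L2_diff\<close>)
  moreover have "(LINT x|vol D. (f s x - h x) \<bullet> g x) = (LINT x|vol D. f s x \<bullet> g x) - (LINT x|vol D. h x \<bullet> g x)" for s
    using L2_inner_integrable[OF assms(1)[of s] assms(3)] L2_inner_integrable[OF assms(2,3)]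
    by (simp add: inner_diff_left)
  ultimately show ?thesis by (simp add: LIM_zero_iff)
qed

text \<open>The weak divergence \<open>d\<close> of the constant field is orthogonal to all test functions and also an
  \<open>L\<^sup>2\<close> limit of test functions \<open>div \<psi>_n\<close>, hence zero. But then the integral of \<open>e_k \<bullet> e_k\<close> is the limit of
  the integrals of \<open>\<psi>_n \<bullet> e_k\<close>, which equal those of \<open>- x_k div \<psi>_n\<close> and tend to zero.\<close>

lemma homogeneous_no_constant_field:
  assumes D: "admissible_domain (Homogeneous W)"
  shows "(\<lambda>x. axis k 1) \<notin> Hdiv_zero (Homogeneous W)"
proof
  let ?D = "Homogeneous W" and ?e = "\<lambda>x::real^2. axis k 1 :: real^2"
  define d where "d = weak_div ?D ?e"
  assume H: "?e \<in> Hdiv_zero ?D"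
  then have "\<exists>d. has_weak_div ?D ?e d" by (auto simp: Hdiv_zero_def Hdiv_def)
  then have wd: "has_weak_div ?D ?e d" unfolding d_def weak_div_def by (rule someI_ex)
  then have d: "d \<in> L2 ?D" by (simp add: has_weak_div_def)
  have d\<phi>: "(LINT x|vol ?D. d x * \<phi> x) = 0" if "\<phi> \<in> test_functions ?D" for \<phi>
    using wd that integral_test_pd[OF D that, of k]
    by (simp add: has_weak_div_def grad_def inner_axis' del: region.simps test_functions.simps)
  obtain \<psi> where \<psi>: "\<And>n. \<psi> n \<in> test_fields ?D"
    "(\<lambda>n. L2_norm ?D (\<lambda>x. \<psi> n x - axis k 1)) \<longlonglongrightarrow> 0"
    "(\<lambda>n. L2_norm ?D (\<lambda>x. (\<Sum>i\<in>UNIV. pd i (\<lambda>y. \<psi> n y $ i) x) - d x)) \<longlonglongrightarrow> 0"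
    using H unfolding Hdiv_zero_def d_def by auto
  define \<delta> where "\<delta> n x = (\<Sum>i\<in>UNIV. pd i (\<lambda>y. \<psi> n y $ i) x)" for n x
  have \<psi>t: "(\<lambda>x. \<psi> n x $ i) \<in> test_functions ?D" for n i
    using \<psi>(1) by (simp add: test_fields_def del: test_functions.simps)
  have \<delta>t: "\<delta> n \<in> test_functions ?D" for n
    unfolding \<delta>_def sum_2 by (intro test_add test_pd \<psi>t)
  have e: "?e \<in> L2 ?D" by (intro continuous_in_L2 D continuous_intros)
  have xk: "(\<lambda>x. x $ k) \<in> L2 ?D" by (intro continuous_in_L2 D continuous_intros)
  have \<psi>L: "\<psi> n \<in> L2 ?D" for n
  proof (rule continuous_in_L2[OF D])
    have "continuous_on UNIV (\<lambda>x. \<chi> i. \<psi> n x $ i)"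
      by (intro continuous_on_vec_lambda smooth_continuous test_smooth[OF \<psi>t])
    then show "continuous_on UNIV (\<psi> n)" by simp
  qed
  note \<delta>L = test_function_in_L2[OF D \<delta>t]
  have \<delta>lim: "(\<lambda>n. LINT x|vol ?D. \<delta> n x * g x) \<longlonglongrightarrow> (LINT x|vol ?D. d x * g x)" if "g \<in> L2 ?D" for g
    using L2_inner_tendsto[OF \<delta>L d that \<psi>(3)[folded \<delta>_def]] by simp
  have "(LINT x|vol ?D. \<delta> n x * d x) = 0" for n
    using d\<phi>[OF \<delta>t] by (simp add: mult.commute)
  with \<delta>lim[OF d] have "(LINT x|vol ?D. d x * d x) = 0"
    by (simp only: LIMSEQ_const_iff)
  then have d0: "AE x in vol ?D. d x = 0" using L2_inner_self_0[OF d] by simp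
  have "(LINT x|vol ?D. \<psi> n x \<bullet> axis k 1) = - (LINT x|vol ?D. \<delta> n x * x $ k)" for n
  proof -
    \<comment> \<open>The factor \<open>x $ k\<close> is harmless because the support is compact; on
      a periodic cell it would destroy periodicity.\<close>
    have t: "(\<lambda>x. x $ k * \<psi> n x $ i) \<in> test_functions ?D" for i
      using \<psi>t[of n i] by (auto simp: smooth_def intro!: Ck_mult Ck_component)
    have p: "pd i (\<lambda>x. x $ k * \<psi> n x $ i) x = x $ k * pd i (\<lambda>y. \<psi> n y $ i) x + axis i 1 $ k * \<psi> n x $ i" for i x
    proof -
      have c: "((\<lambda>x::real^2. x $ k) has_derivative (\<lambda>h. h $ k)) (at x)"
        by (rule bounded_linear.has_derivative[OF bounded_linear_vec_nth]) (rule has_derivative_ident)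
      then have "pd i (\<lambda>x. x $ k) x = axis i 1 $ k" by (rule pd_eqI)
      then show ?thesis
        using pd_mult[of "\<lambda>x. x $ k" x "\<lambda>y. \<psi> n y $ i" i] c smooth_differentiable[OF test_smooth[OF \<psi>t]]
        by (auto simp: differentiable_def)
    qed
    have "0 = (\<Sum>i\<in>UNIV. LINT x|vol ?D. pd i (\<lambda>x. x $ k * \<psi> n x $ i) x)"
      using integral_test_pd[OF D t] by simp
    also have "\<dots> = (LINT x|vol ?D. (\<Sum>i\<in>UNIV. pd i (\<lambda>x. x $ k * \<psi> n x $ i) x))"
    proof (rule Bochner_Integration.integral_sum[symmetric])
      interpret finite_measure "vol ?D" by (rule finite_measure_vol[OF D])
      have one: "(\<lambda>x. 1::real) \<in> L2 ?D" by (intro continuous_in_L2 D continuous_intros)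
      show "integrable (vol ?D) (pd i (\<lambda>x. x $ k * \<psi> n x $ i))" for i
        using L2_mult_integrable[OF test_function_in_L2[OF D test_pd[OF t]] one] by simp
    qed
    also have "\<dots> = (LINT x|vol ?D. \<delta> n x * x $ k + \<psi> n x \<bullet> axis k 1)"
    proof (intro Bochner_Integration.integral_cong refl)
      fix x
      have "(\<Sum>i\<in>UNIV. axis i 1 $ k * \<psi> n x $ i) = \<psi> n x $ k"
        by (simp add: axis_def if_distrib[of "\<lambda>z. z * _"] cong: if_cong)
      then show "(\<Sum>i\<in>UNIV. pd i (\<lambda>x. x $ k * \<psi> n x $ i) x) = \<delta> n x * x $ k + \<psi> n x \<bullet> axis k 1"
        by (simp add: p sum.distrib \<delta>_def sum_distrib_left inner_axis mult.commute)
    qed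
    also have "\<dots> = (LINT x|vol ?D. \<delta> n x * x $ k) + (LINT x|vol ?D. \<psi> n x \<bullet> axis k 1)"
      by (intro Bochner_Integration.integral_add L2_mult_integrable \<delta>L xk L2_inner_integrable \<psi>L e)
    finally show ?thesis by simp
  qed
  moreover have "(\<lambda>n. LINT x|vol ?D. \<psi> n x \<bullet> axis k 1) \<longlonglongrightarrow> (LINT x|vol ?D. axis k 1 \<bullet> (axis k 1 :: real^2))"
    by (rule L2_inner_tendsto[OF \<psi>L e e \<psi>(2)])
  moreover have "(\<lambda>n. - (LINT x|vol ?D. \<delta> n x * x $ k)) \<longlonglongrightarrow> - (LINT x|vol ?D. d x * x $ k)"
    by (intro tendsto_minus \<delta>lim xk)
  moreover have "(LINT x|vol ?D. d x * x $ k) = 0"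
    by (rule integral_eq_zero_AE) (use d0 in auto)
  ultimately have "(LINT x|vol ?D. axis k 1 \<bullet> (axis k 1 :: real^2)) = 0"
    using LIMSEQ_unique by fastforce
  then have "measure (vol ?D) (space (vol ?D)) = 0"
    by (simp add: inner_axis)
  moreover have "emeasure lborel W \<noteq> 0"
    using D open_not_negligible[of W] by (auto simp: lipschitz_domain_def negligible_iff_emeasure0 emeasure_completion)
  ultimately show False
    using finite_measure.emeasure_eq_measure[OF finite_measure_vol[OF D], of "space (vol ?D)"] region_sets[OF D]
    by (simp add: space_restrict_space emeasure_restrict_space)
qed

section \<open>The fundamental lemma of the calculus of variations on a periodicity cell\<close>

text \<open>With the period scaled to the full circle, \<open>\<theta>\<close> is the angle from
  \<open>x\<close> to the midpoint of the interval and \<open>r\<close> is half the angle of the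
  interval. The cosine decreases on \<open>[0, pi]\<close>; larger angles are reflected to
  \<open>2 * pi - \<theta>\<close>.\<close>

lemma cos_arc:
  fixes a b c d x :: real
  assumes "a \<le> c" "c < d" "d \<le> b" "a < x" "x < b"
  defines "L \<equiv> b - a"
  shows "c < x \<Longrightarrow> x < d \<Longrightarrow> cos (2 * pi / L * (x - (c + d) / 2)) > cos (pi * (d - c) / L)"
    and "x < c \<or> d < x \<Longrightarrow> cos (2 * pi / L * (x - (c + d) / 2)) < cos (pi * (d - c) / L)"
proof -
  have L: "L > 0" "d - c \<le> L" using assms by auto
  define r where "r = pi * (d - c) / L"
  define \<theta> where "\<theta> = 2 * pi / L * \<bar>x - (c + d) / 2\<bar>"
  have r: "0 < r" "r \<le> pi" using L assms(2) by (auto simp: r_def pos_divide_le_eq)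
  have \<theta>: "\<theta> \<ge> 0" using L by (simp add: \<theta>_def)
  have c\<theta>: "cos (2 * pi / L * (x - (c + d) / 2)) = cos \<theta>"
  proof -
    have "\<theta> = \<bar>2 * pi / L * (x - (c + d) / 2)\<bar>" using L by (simp add: \<theta>_def abs_mult)
    then show ?thesis by (simp only: cos_abs_real)
  qed
  have scale: "2 * pi / L * s < 2 * pi / L * t" if "s < t" for s t
    using that L by (intro mult_strict_left_mono) auto
  have r': "r = 2 * pi / L * ((d - c) / 2)" by (simp add: r_def)
  { assume "c < x" "x < d"
    then have "\<bar>x - (c + d) / 2\<bar> < (d - c) / 2" by (auto simp: abs_if field_simps)
    from scale[OF this] have "\<theta> < r" unfolding \<theta>_def r' .
    then have "cos r < cos \<theta>" using \<theta> r by (intro cos_monotone_0_pi) auto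
    then show "cos (2 * pi / L * (x - (c + d) / 2)) > cos (pi * (d - c) / L)"
      by (simp only: c\<theta> r_def) }
  { assume "x < c \<or> d < x"
    then have "(d - c) / 2 < \<bar>x - (c + d) / 2\<bar>" using assms(2) by (auto simp: abs_if field_simps)
    from scale[OF this] have 1: "r < \<theta>" unfolding \<theta>_def r' .
    \<comment> \<open>Going round the circle must not reach the interval again from its other end.
      The bounds \<open>a \<le> c\<close> and \<open>d \<le> b\<close> ensure this, one for each
      sign of the difference.\<close>
    have "\<bar>x - (c + d) / 2\<bar> < L - (d - c) / 2"
      using assms by (auto simp: L_def abs_if field_simps)
    from scale[OF this] have 2: "\<theta> < 2 * pi - r"
      using L unfolding \<theta>_def r' by (simp add: right_diff_distrib)
    have "cos \<theta> < cos r"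
    proof (cases "\<theta> \<le> pi")
      case True
      then show ?thesis using 1 r by (intro cos_monotone_0_pi) auto
    next
      case False
      have "cos (2 * pi - \<theta>) < cos r"
        using False 2 r by (intro cos_monotone_0_pi) auto
      then show ?thesis by (simp add: cos_diff)
    qed
    then show "cos (2 * pi / L * (x - (c + d) / 2)) < cos (pi * (d - c) / L)"
      by (simp only: c\<theta> r_def) }
qed

lemma logistic_scale_tendsto_1:
  assumes "t > 0"
  shows "(\<lambda>n. logistic (real n * t)) \<longlonglongrightarrow> 1"
proof -
  have "logistic (real n * t) = 1 / (1 + exp (- t) ^ n)" for n
    by (simp add: logistic_def exp_of_nat_mult[symmetric])
  moreover have "(\<lambda>n. exp (- t) ^ n) \<longlonglongrightarrow> 0"
    using assms by (intro LIMSEQ_realpow_zero) auto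
  then have "(\<lambda>n. 1 / (1 + exp (- t) ^ n)) \<longlonglongrightarrow> 1 / (1 + 0)"
    by (intro tendsto_divide tendsto_add tendsto_const) auto
  ultimately show ?thesis by simp
qed

text \<open>The reflection \<open>1 - logistic (- y) = logistic y\<close> turns this into the limit
  1 for positive arguments.\<close>

lemma logistic_scale_tendsto_0:
  assumes "t < 0"
  shows "(\<lambda>n. logistic (real n * t)) \<longlonglongrightarrow> 0"
proof -
  have "(\<lambda>n. 1 - logistic (real n * (- t))) \<longlonglongrightarrow> 1 - 1"
    using assms by (intro tendsto_diff tendsto_const logistic_scale_tendsto_1) auto
  moreover have "1 - logistic (- y) = logistic y" for y
    by (simp add: logistic_def exp_minus field_simps add_pos_pos add_nonneg_eq_0_iff)
  ultimately show ?thesis by simp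
qed

text \<open>Used to discard the faces of a box: there the argument of \<open>logistic\<close> is 0
  for every \<open>n\<close>, so the factor stays at 1/2.\<close>

lemma AE_component_neq: "AE x in lebesgue_on S. x $ i \<noteq> (c::real)"
  if "S \<in> sets lebesgue" for S :: "(real^2) set"
proof -
  have "{x::real^2. x $ i = c} \<in> null_sets lebesgue"
    using negligible_hyperplane[of "axis i 1 :: real^2" c]
    by (simp add: negligible_iff_null_sets inner_axis' inner_real_def axis_eq_0_iff)
  then have "AE x in lebesgue. x $ i \<noteq> c" by (rule AE_I') auto
  then show ?thesis using that by (subst AE_restrict_space_iff) auto
qed

text \<open>The indicator function of a box is the limit of the smooth periodic functions
  \<open>\<Prod>i. logistic (n (cos (2 \<pi> (x_i - m_i) / L_i) - \<kappa>_i))\<close>: an interval is an arc of the circle, cut out by a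
  bound on the cosine.\<close>

lemma periodic_box_integral_0:
  assumes D: "admissible_domain (Periodic a b)" and d: "d \<in> L2 (Periodic a b)"
    and orth: "\<And>\<phi>. \<phi> \<in> test_functions (Periodic a b) \<Longrightarrow> (LINT x|vol (Periodic a b). d x * \<phi> x) = 0"
    and le: "\<And>i. a $ i \<le> p $ i" "\<And>i. p $ i < q $ i" "\<And>i. q $ i \<le> b $ i"
  shows "(LINT x|vol (Periodic a b). indicator (box p q) x * d x) = 0"
proof -
  let ?V = "vol (Periodic a b)"
  define L where "L i = b $ i - a $ i" for i :: 2
  define g where "g i x = cos (2 * pi / L i * (x $ i - (p $ i + q $ i) / 2)) - cos (pi * (q $ i - p $ i) / L i)" for i and x :: "real^2"
  define w where "w n i x = logistic (real n * g i x)" for n i and x :: "real^2"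
  have L: "L i > 0" for i using D by (simp add: L_def)
  have gC: "smooth (w n i)" for n i
  proof -
    have eq: "w n i = (\<lambda>x. logistic (real n * (cos (2 * pi / L i * x $ i + - (2 * pi / L i * ((p $ i + q $ i) / 2)))
        + - cos (pi * (q $ i - p $ i) / L i))))"
      by (simp add: w_def g_def fun_eq_iff right_diff_distrib)
    have "Ck k (w n i)" for k
      unfolding eq by (intro Ck_logistic Ck_mult Ck_add Ck_const Ck_cos)
    then show ?thesis by (simp add: smooth_def)
  qed
  have gper: "w n i (x + axis j (b $ j - a $ j)) = w n i x" for n i j x
  proof (cases "j = i")
    case True
    have "2 * pi / L i * (x $ i + L i - (p $ i + q $ i) / 2) = 2 * pi / L i * (x $ i - (p $ i + q $ i) / 2) + 2 * pi"
      using L[of i] by (simp add: field_simps)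
    then have "g i (x + axis j (b $ j - a $ j)) = g i x"
      using True by (simp add: g_def axis_def L_def[symmetric])
    then show ?thesis by (simp add: w_def)
  qed (auto simp: w_def g_def axis_def)
  define \<phi> where "\<phi> n x = w n 1 x * w n 2 x" for n x
  have \<phi>t: "\<phi> n \<in> test_functions (Periodic a b)" for n
    unfolding \<phi>_def using gC gper by (auto intro!: smooth_mult)
  have w01: "0 \<le> w n i x" "w n i x \<le> 1" for n i x
    using logistic_bounds[of "real n * g i x"] by (auto simp: w_def)
  have \<phi>01: "0 \<le> \<phi> n x" "\<phi> n x \<le> 1" for n x
    using w01 by (auto simp: \<phi>_def intro!: mult_le_one)
  have ae: "AE x in ?V. (\<lambda>n. \<phi> n x) \<longlonglongrightarrow> indicator (box p q) x"
  proof -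
    have S: "region (Periodic a b) \<in> sets lebesgue" using region_sets[OF D] by auto
    have "AE x in ?V. \<forall>i. x $ i \<noteq> p $ i \<and> x $ i \<noteq> q $ i"
      using AE_component_neq[OF S] by (auto simp: forall_2)
    moreover have "AE x in ?V. x \<in> box a b"
      by (rule AE_I2) (simp add: space_restrict_space)
    ultimately show ?thesis
    proof eventually_elim
      case (elim x)
      have x: "a $ i < x $ i" "x $ i < b $ i" for i using elim by (auto simp: mem_box_cart)
      have lim: "(\<lambda>n. w n i x) \<longlonglongrightarrow> (if p $ i < x $ i \<and> x $ i < q $ i then 1 else 0)" for i
      proof (cases "p $ i < x $ i \<and> x $ i < q $ i")
        case True
        then have "g i x > 0"
          using cos_arc(1)[OF le(1)[of i] le(2)[of i] le(3)[of i] x] by (simp add: g_def L_def)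
        then show ?thesis using True logistic_scale_tendsto_1 by (simp add: w_def)
      next
        case False
        moreover have "x $ i \<noteq> p $ i" "x $ i \<noteq> q $ i" using elim by auto
        ultimately have "x $ i < p $ i \<or> q $ i < x $ i" by linarith
        then have "g i x < 0"
          using cos_arc(2)[OF le(1)[of i] le(2)[of i] le(3)[of i] x] by (simp add: g_def L_def)
        then show ?thesis using False logistic_scale_tendsto_0 by (auto simp: w_def)
      qed
      have "(\<lambda>n. \<phi> n x) \<longlonglongrightarrow> (if p $ 1 < x $ 1 \<and> x $ 1 < q $ 1 then 1 else 0) * (if p $ 2 < x $ 2 \<and> x $ 2 < q $ 2 then 1 else 0)"
        unfolding \<phi>_def by (intro tendsto_mult lim)
      then show ?case by (auto simp: indicator_def mem_box_cart forall_2 split: if_splits)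
    qed
  qed
  note [measurable] = L2_measurable[OF d] L2_measurable[OF test_function_in_L2[OF D \<phi>t]]
  have one: "(\<lambda>x. 1::real) \<in> L2 (Periodic a b)" by (intro continuous_in_L2 D continuous_intros)
  have "(\<lambda>n. LINT x|?V. \<phi> n x * d x) \<longlonglongrightarrow> (LINT x|?V. indicator (box p q) x * d x)"
  proof (rule integral_dominated_convergence[where w = "\<lambda>x. \<bar>d x\<bar>"])
    show "integrable ?V (\<lambda>x. \<bar>d x\<bar>)" using L2_mult_integrable[OF d one] by simp
    show "AE x in ?V. (\<lambda>n. \<phi> n x * d x) \<longlonglongrightarrow> indicator (box p q) x * d x"
      using ae by eventually_elim (intro tendsto_mult tendsto_const)
    show "AE x in ?V. norm (\<phi> n x * d x) \<le> \<bar>d x\<bar>" for n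
      using \<phi>01 by (auto simp: abs_mult intro!: mult_left_le_one_le)
    have "indicator (box p q) \<in> borel_measurable ?V"
      by (intro measurable_restrict_space1 borel_measurable_indicator) simp
    then show "(\<lambda>x. indicator (box p q) x * d x) \<in> borel_measurable ?V" by measurable
  qed measurable
  moreover have "(LINT x|?V. \<phi> n x * d x) = 0" for n
    using orth[OF \<phi>t] by (simp only: mult.commute)
  ultimately show ?thesis by (simp only: LIMSEQ_const_iff)
qed

text \<open>Boxes are stable under intersection and generate the Borel sets, so the integral of
  \<open>d\<close> vanishes over every Borel set, then over every Lebesgue set, and a density with
  this property is zero almost everywhere.\<close>

lemma periodic_fundamental_lemma:
  assumes D: "admissible_domain (Periodic a b)" and d: "d \<in> L2 (Periodic a b)"
    and orth: "\<And>\<phi>. \<phi> \<in> test_functions (Periodic a b) \<Longrightarrow> (LINT x|vol (Periodic a b). d x * \<phi> x) = 0"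
  shows "AE x in vol (Periodic a b). d x = 0"
proof -
  let ?V = "vol (Periodic a b)"
  have one: "(\<lambda>x. 1::real) \<in> L2 (Periodic a b)" by (intro continuous_in_L2 D continuous_intros)
  have di: "integrable ?V d" using L2_mult_integrable[OF d one] by simp
  have ab: "a $ i < b $ i" for i using D by simp
  have boxi: "(LINT x|?V. indicator (box p q) x * d x) = 0" for p q
  proof -
    \<comment> \<open>An arbitrary box is clipped to the cell, since the approximation by periodic
      functions is made only for boxes inside it.\<close>
    define p' q' where "p' = (\<chi> i. max (p $ i) (a $ i))" and "q' = (\<chi> i. min (q $ i) (b $ i))"
    have "(LINT x|?V. indicator (box p q) x * d x) = (LINT x|?V. indicator (box p' q') x * d x)"
      by (intro Bochner_Integration.integral_cong refl)
         (auto simp: space_restrict_space indicator_def mem_box_cart p'_def q'_def)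
    also have "\<dots> = 0"
    proof (cases "\<forall>i. p' $ i < q' $ i")
      case True
      then show ?thesis by (intro periodic_box_integral_0[OF D d orth]) (auto simp: p'_def q'_def)
    next
      case False
      then have "box p' q' = {}" by (auto simp: interval_eq_empty_cart not_less)
      then show ?thesis by simp
    qed
    finally show ?thesis .
  qed
  have setm: "A \<inter> box a b \<in> sets ?V" if "A \<in> sets lebesgue" for A
    using that by (auto simp: sets_restrict_space)
  have borel: "(LINT x:A|?V. d x) = 0" if "A \<in> sets borel" for A
  proof -
    let ?G = "range (\<lambda>(p, q). box p q :: (real^2) set)"
    have sb: "sigma_sets UNIV ?G = sets borel" by (simp add: borel_eq_box)
    have meas: "A \<inter> box a b \<in> sets ?V" if "A \<in> sigma_sets UNIV ?G" for A
      using that by (intro setm) (auto simp: sb)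
    have cut: "(LINT x:A \<inter> box a b|?V. d x) = (LINT x:A|?V. d x)" for A
      unfolding set_lebesgue_integral_def
      by (intro Bochner_Integration.integral_cong refl) (auto simp: space_restrict_space indicator_def)
    have si: "set_integrable ?V (A \<inter> box a b) d" if "A \<in> sigma_sets UNIV ?G" for A
      unfolding set_integrable_def by (intro integrable_mult_indicator meas that di)
    have "Int_stable ?G"
      by (force simp: Int_stable_def box_Int_box)
    moreover have "?G \<subseteq> Pow UNIV" by simp
    moreover have "A \<in> sigma_sets UNIV ?G" using that sb by simp
    ultimately show ?thesis
    proof (induction rule: sigma_sets_induct_disjoint)
      case (basic A)
      then show ?case using boxi by (auto simp: set_lebesgue_integral_def)
    next
      case empty
      show ?case by (simp add: set_lebesgue_integral_def)
    next
      case (compl A)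
      have "(LINT x:(UNIV - A)|?V. d x) = (LINT x|?V. d x - indicator (A \<inter> box a b) x *\<^sub>R d x)"
        unfolding set_lebesgue_integral_def
        by (intro Bochner_Integration.integral_cong refl) (auto simp: space_restrict_space indicator_def)
      also have "\<dots> = (LINT x|?V. d x) - (LINT x:A \<inter> box a b|?V. d x)"
        using si[OF compl(1)] di by (simp add: set_integrable_def set_lebesgue_integral_def)
      \<comment> \<open>The whole cell is itself a box, so the total integral vanishes; this is what
        makes complements work.\<close>
      also have "(LINT x|?V. d x) = (LINT x|?V. indicator (box a b) x * d x)"
        by (intro Bochner_Integration.integral_cong refl) (auto simp: space_restrict_space)
      finally show ?case using boxi cut compl by simp
    next
      case (union A)
      have "(LINT x:(\<Union>i. A i \<inter> box a b)|?V. d x) = (\<Sum>i. (LINT x:(A i \<inter> box a b)|?V. d x))"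
      proof (rule lebesgue_integral_countable_add)
        show "\<And>i. A i \<inter> box a b \<in> sets ?V" using union meas by blast
        show "\<And>i j. i \<noteq> j \<Longrightarrow> (A i \<inter> box a b) \<inter> (A j \<inter> box a b) = {}"
          using union(1) by (auto simp: disjoint_family_on_def)
        have "(\<Union>i. A i) \<in> sigma_sets UNIV ?G" using union(2) by (intro sigma_sets.Union) auto
        from si[OF this] show "set_integrable ?V (\<Union>i. A i \<inter> box a b) d" by simp
      qed
      then have "(LINT x:(\<Union>i. A i \<inter> box a b)|?V. d x) = 0"
        using union(3) by (simp only: cut) simp
      moreover have "(\<Union>i. A i \<inter> box a b) = (\<Union>i. A i) \<inter> box a b" by blast
      ultimately show ?case by (simp only: cut)
    qed
  qed
  show ?thesis
  proof (rule density_unique_real[OF di])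
    fix A assume "A \<in> sets ?V"
    then have "A \<in> sets lebesgue" using region_sets[OF D] by (auto simp: sets_restrict_space)
    \<comment> \<open>A Lebesgue set is a Borel set up to a null set, which the integral does not
      see.\<close>
    then obtain S N N' where SN: "A = S \<union> N" "N \<subseteq> N'" "N' \<in> null_sets lborel" "S \<in> sets lborel"
      by (rule sets_completionE) blast
    have "N' \<in> null_sets lebesgue" using SN null_sets_completionI by blast
    then have "AE x in lebesgue. x \<notin> N'" by (rule AE_not_in)
    then have "AE x in ?V. x \<notin> N'" using region_sets[OF D] by (subst AE_restrict_space_iff) auto
    then have ae: "AE x in ?V. indicator A x *\<^sub>R d x = indicator S x *\<^sub>R d x"
      by eventually_elim (use SN in \<open>auto simp: indicator_def\<close>)
    have m: "(\<lambda>x. indicator B x *\<^sub>R d x) \<in> borel_measurable ?V" if "B \<in> sets lebesgue" for B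
      by (intro borel_measurable_scaleR L2_measurable[OF d] measurable_restrict_space1[OF borel_measurable_indicator] that)
    have "(LINT x:A|?V. d x) = (LINT x:S|?V. d x)"
      unfolding set_lebesgue_integral_def
      by (intro integral_cong_AE ae m) (use SN \<open>A \<in> sets lebesgue\<close> in auto)
    then show "(LINT x:A|?V. d x) = (LINT x:A|?V. 0)"
      using borel SN by (simp add: set_lebesgue_integral_def)
  qed simp
qed

section \<open>Riesz representation on discrete spaces\<close>

definition L2_inner :: "flow_domain \<Rightarrow> (real^2 \<Rightarrow> 'a::euclidean_space) \<Rightarrow> (real^2 \<Rightarrow> 'a) \<Rightarrow> real" where
  "L2_inner D f g = (LINT x|vol D. f x \<bullet> g x)"

lemma L2_inner_commute: "L2_inner D f g = L2_inner D g f"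
  by (simp add: L2_inner_def inner_commute)

lemma L2_inner_add_right:
  "f \<in> L2 D \<Longrightarrow> g \<in> L2 D \<Longrightarrow> h \<in> L2 D \<Longrightarrow> L2_inner D f (\<lambda>x. g x + h x) = L2_inner D f g + L2_inner D f h"
  by (simp add: L2_inner_def inner_add_right L2_inner_integrable)

lemma L2_inner_scaleR_right: "L2_inner D f (\<lambda>x. c *\<^sub>R g x) = c * L2_inner D f g"
  by (simp add: L2_inner_def)

lemma L2_inner_add_left:
  "f \<in> L2 D \<Longrightarrow> g \<in> L2 D \<Longrightarrow> h \<in> L2 D \<Longrightarrow> L2_inner D (\<lambda>x. f x + g x) h = L2_inner D f h + L2_inner D g h"
  by (simp add: L2_inner_commute[of D _ h] L2_inner_add_right)

lemma L2_inner_scaleR_left: "L2_inner D (\<lambda>x. c *\<^sub>R f x) g = c * L2_inner D f g"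
  by (simp add: L2_inner_def)

lemma L2_inner_diff_left:
  "f \<in> L2 D \<Longrightarrow> g \<in> L2 D \<Longrightarrow> h \<in> L2 D \<Longrightarrow> L2_inner D (\<lambda>x. f x - g x) h = L2_inner D f h - L2_inner D g h"
  by (simp add: L2_inner_def inner_diff_left L2_inner_integrable)

lemma L2_inner_cong_AE:
  assumes "f \<in> L2 D" "g \<in> L2 D" "h \<in> L2 D" "AE x in vol D. g x = h x"
  shows "L2_inner D f g = L2_inner D f h"
  unfolding L2_inner_def
proof (rule integral_cong_AE)
  show "AE x in vol D. f x \<bullet> g x = f x \<bullet> h x" using assms(4) by eventually_elim simp
qed (use assms(1-3)[THEN L2_measurable] in measurable)

lemma L2_inner_zero_AE: "AE x in vol D. g x = 0 \<Longrightarrow> L2_inner D f g = 0"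
  unfolding L2_inner_def by (rule integral_eq_zero_AE) auto

text \<open>Members of a discrete space are representatives, so a functional on the quotient must
  also respect equality almost everywhere. Linearity is asked on \<open>V\<close> only, because
  \<open>weak_div\<close> is meaningful only for fields that have a weak divergence.\<close>

definition ae_linear :: "flow_domain \<Rightarrow> (real^2 \<Rightarrow> 'a::euclidean_space) set \<Rightarrow> ((real^2 \<Rightarrow> 'a) \<Rightarrow> real) \<Rightarrow> bool" where
  "ae_linear D V F \<longleftrightarrow>
     (\<forall>f\<in>V. \<forall>g\<in>V. F (\<lambda>x. f x + g x) = F f + F g) \<and>
     (\<forall>f\<in>V. \<forall>c. F (\<lambda>x. c *\<^sub>R f x) = c * F f) \<and>
     (\<forall>f\<in>V. \<forall>g\<in>V. (AE x in vol D. f x = g x) \<longrightarrow> F f = F g)"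

lemma ae_linear_add: "ae_linear D V F \<Longrightarrow> f \<in> V \<Longrightarrow> g \<in> V \<Longrightarrow> F (\<lambda>x. f x + g x) = F f + F g"
  and ae_linear_scaleR: "ae_linear D V F \<Longrightarrow> f \<in> V \<Longrightarrow> F (\<lambda>x. c *\<^sub>R f x) = c * F f"
  and ae_linear_cong: "ae_linear D V F \<Longrightarrow> f \<in> V \<Longrightarrow> g \<in> V \<Longrightarrow> AE x in vol D. f x = g x \<Longrightarrow> F f = F g"
  unfolding ae_linear_def by blast+

lemma ae_linear_L2_inner: "f \<in> L2 D \<Longrightarrow> V \<subseteq> L2 D \<Longrightarrow> ae_linear D V (L2_inner D f)"
  unfolding ae_linear_def
  by (auto simp: L2_inner_scaleR_right intro!: L2_inner_add_right L2_inner_cong_AE)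

lemma discrete_space_zero: "discrete_space D V \<Longrightarrow> (\<lambda>x. 0) \<in> V"
  and discrete_space_add: "discrete_space D V \<Longrightarrow> f \<in> V \<Longrightarrow> g \<in> V \<Longrightarrow> (\<lambda>x. f x + g x) \<in> V"
  and discrete_space_scaleR: "discrete_space D V \<Longrightarrow> f \<in> V \<Longrightarrow> (\<lambda>x. c *\<^sub>R f x) \<in> V"
  and discrete_space_AE: "discrete_space D V \<Longrightarrow> f \<in> V \<Longrightarrow> AE x in vol D. f x = g x \<Longrightarrow> g \<in> V"
  and discrete_space_span: "discrete_space D V \<Longrightarrow>
    \<exists>B\<subseteq>V. finite B \<and> (\<forall>f\<in>V. \<exists>c. AE x in vol D. f x = (\<Sum>b\<in>B. c b *\<^sub>R b x))"
  unfolding discrete_space_def by blast+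

lemma discrete_space_diff:
  "discrete_space D V \<Longrightarrow> f \<in> V \<Longrightarrow> g \<in> V \<Longrightarrow> (\<lambda>x. f x - g x) \<in> V"
  using discrete_space_add[of D V f "\<lambda>x. -1 *\<^sub>R g x"] discrete_space_scaleR[of D V g "-1"] by simp

lemma discrete_space_sum:
  assumes "discrete_space D V" "finite B" "B \<subseteq> V"
  shows "(\<lambda>x. \<Sum>b\<in>B. c b *\<^sub>R b x) \<in> V"
  using assms(2,3)
  by (induction) (auto intro: discrete_space_add[OF assms(1)] discrete_space_scaleR[OF assms(1)] discrete_space_zero[OF assms(1)])

lemma ae_linear_sum:
  assumes V: "discrete_space D V" and F: "ae_linear D V F" and B: "finite B" "B \<subseteq> V"
  shows "F (\<lambda>x. \<Sum>b\<in>B. c b *\<^sub>R b x) = (\<Sum>b\<in>B. c b * F b)"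
  using B
proof (induction)
  case empty
  show ?case using ae_linear_scaleR[OF F discrete_space_zero[OF V], of 0] by simp
next
  case (insert b B)
  have "F (\<lambda>x. c b *\<^sub>R b x + (\<Sum>b\<in>B. c b *\<^sub>R b x)) = F (\<lambda>x. c b *\<^sub>R b x) + F (\<lambda>x. \<Sum>b\<in>B. c b *\<^sub>R b x)"
    using insert by (intro ae_linear_add[OF F] discrete_space_scaleR[OF V] discrete_space_sum[OF V]) auto
  also have "F (\<lambda>x. c b *\<^sub>R b x) = c b * F b"
    using insert by (intro ae_linear_scaleR[OF F]) auto
  finally show ?case using insert by simp
qed

text \<open>Gram--Schmidt: the new basis element is replaced by its component orthogonal to the span of
  the old ones, which may vanish almost everywhere since the spanning set need not be independent.\<close>

lemma riesz_on_spanning_set: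
  assumes V: "discrete_space D V" "V \<subseteq> L2 D" and B: "finite B" "B \<subseteq> V"
    and F: "ae_linear D V F"
  shows "\<exists>c. \<forall>b\<in>B. L2_inner D (\<lambda>x. \<Sum>a\<in>B. c a *\<^sub>R a x) b = F b"
  using B F
proof (induction arbitrary: F)
  case (insert b B)
  have bV: "b \<in> V" and BV: "B \<subseteq> V" using insert.prems by auto
  define comb where "comb c x = (\<Sum>a\<in>B. c a *\<^sub>R a x)" for c :: "(real^2 \<Rightarrow> 'a) \<Rightarrow> real" and x
  have combV: "comb c \<in> V" for c
    using discrete_space_sum[OF V(1) insert.hyps(1) BV, of c] unfolding comb_def[abs_def] .
  have lin: "G (comb c) = (\<Sum>a\<in>B. c a * G a)" if "ae_linear D V G" for G c
    using ae_linear_sum[OF V(1) that insert.hyps(1) BV, of c] unfolding comb_def[abs_def] .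
  have VL: "f \<in> L2 D" if "f \<in> V" for f using V(2) that by blast
  have "\<exists>c. \<forall>a\<in>B. L2_inner D (comb c) a = L2_inner D b a"
    using insert.IH[OF BV ae_linear_L2_inner[OF VL[OF bV] V(2)]] unfolding comb_def[abs_def] .
  then obtain c0 where c0: "\<And>a. a \<in> B \<Longrightarrow> L2_inner D (comb c0) a = L2_inner D b a" by blast
  have "\<exists>c. \<forall>a\<in>B. L2_inner D (comb c) a = F a"
    using insert.IH[OF BV insert.prems(2)] unfolding comb_def[abs_def] .
  then obtain c1 where c1: "\<And>a. a \<in> B \<Longrightarrow> L2_inner D (comb c1) a = F a" by blast
  define r where "r x = b x - comb c0 x" for x
  have rV: "r \<in> V" unfolding r_def[abs_def] by (rule discrete_space_diff[OF V(1) bV combV])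
  have ra: "L2_inner D r a = 0" if "a \<in> B" for a
    using that BV c0[OF that] by (simp add: r_def[abs_def] L2_inner_diff_left VL bV combV subsetD)
  have "ae_linear D V (L2_inner D r)" by (rule ae_linear_L2_inner[OF VL[OF rV] V(2)])
  from lin[OF this] have rc0: "L2_inner D r (comb c0) = 0" using ra by simp
  \<comment> \<open>The candidate solves the problem on \<open>B\<close> through
    \<open>comb c1\<close> and is corrected along \<open>r\<close>, which is orthogonal to
    \<open>B\<close>; these are its coefficients with respect to the enlarged set.\<close>
  have expand: "(\<Sum>a\<in>insert b B. (if a = b then s else c1 a - s * c0 a) *\<^sub>R a x) = comb c1 x + s *\<^sub>R r x" for s x
  proof -
    have "(\<Sum>a\<in>B. (if a = b then s else c1 a - s * c0 a) *\<^sub>R a x) = (\<Sum>a\<in>B. c1 a *\<^sub>R a x - s *\<^sub>R (c0 a *\<^sub>R a x))"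
      using insert.hyps by (intro sum.cong) (auto simp: algebra_simps)
    also have "\<dots> = comb c1 x - s *\<^sub>R comb c0 x"
      by (simp add: comb_def sum_subtractf scaleR_sum_right)
    finally show ?thesis using insert.hyps by (simp add: r_def algebra_simps)
  qed
  \<comment> \<open>The one value that fits the condition at \<open>b\<close>, because the product
    of \<open>r\<close> with \<open>b\<close> equals that of \<open>r\<close> with itself. For
    vanishing \<open>r\<close> no correction is required, and 0 is taken.\<close>
  define s where "s = (if L2_inner D r r = 0 then 0 else (F b - L2_inner D (comb c1) b) / L2_inner D r r)"
  have val: "L2_inner D (\<lambda>x. comb c1 x + s *\<^sub>R r x) f = L2_inner D (comb c1) f + s * L2_inner D r f" if "f \<in> V" for f
    using that by (simp add: L2_inner_add_left L2_inner_scaleR_left VL combV rV L2_scaleR)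
  have atb: "L2_inner D (comb c1) b + s * L2_inner D r b = F b"
  proof (cases "L2_inner D r r = 0")
    case True
    then have "AE x in vol D. r x = 0" using L2_inner_self_0[OF VL[OF rV]] by (simp add: L2_inner_def)
    then have ae: "AE x in vol D. b x = comb c0 x" by eventually_elim (simp add: r_def)
    \<comment> \<open>Here \<open>b\<close> already lies in the old span up to a null set, so
      linearity forces its value; the condition at \<open>b\<close> is then inherited from
      \<open>B\<close>.\<close>
    have "F b = F (comb c0)" by (rule ae_linear_cong[OF insert.prems(2) bV combV ae])
    also have "\<dots> = (\<Sum>a\<in>B. c0 a * F a)" by (rule lin[OF insert.prems(2)])
    also have "\<dots> = (\<Sum>a\<in>B. c0 a * L2_inner D (comb c1) a)" using c1 by simp
    also have "\<dots> = L2_inner D (comb c1) (comb c0)"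
      by (rule lin[symmetric]) (rule ae_linear_L2_inner[OF VL[OF combV] V(2)])
    also have "\<dots> = L2_inner D (comb c1) b"
      by (rule L2_inner_cong_AE[symmetric, OF _ _ _ ae]) (auto intro: VL combV bV)
    finally show ?thesis using True by (simp add: s_def)
  next
    case False
    have "L2_inner D r b = L2_inner D r (\<lambda>x. r x + comb c0 x)" by (simp add: r_def[abs_def])
    also have "\<dots> = L2_inner D r r" using rc0 by (simp add: L2_inner_add_right VL rV combV)
    finally show ?thesis using False by (simp add: s_def)
  qed
  show ?case
  proof (intro exI[of _ "\<lambda>a. if a = b then s else c1 a - s * c0 a"] ballI)
    fix f assume "f \<in> insert b B"
    then show "L2_inner D (\<lambda>x. \<Sum>a\<in>insert b B. (if a = b then s else c1 a - s * c0 a) *\<^sub>R a x) f = F f"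
      unfolding expand using val[of f] atb ra c1 bV BV by auto
  qed
qed simp

text \<open>Both sides are linear and blind to null sets, so agreement on a spanning set suffices.
  This existence statement gives \<open>L2_proj\<close> and \<open>grad_h\<close> their defining
  properties.\<close>

lemma riesz_discrete:
  assumes V: "discrete_space D V" "V \<subseteq> L2 D" and F: "ae_linear D V F"
  shows "\<exists>g\<in>V. \<forall>v\<in>V. L2_inner D g v = F v"
proof -
  obtain B where B: "B \<subseteq> V" "finite B" "\<And>f. f \<in> V \<Longrightarrow> \<exists>c. AE x in vol D. f x = (\<Sum>b\<in>B. c b *\<^sub>R b x)"
    using discrete_space_span[OF V(1)] by blast
  obtain c where c: "\<And>b. b \<in> B \<Longrightarrow> L2_inner D (\<lambda>x. \<Sum>a\<in>B. c a *\<^sub>R a x) b = F b"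
    using riesz_on_spanning_set[OF V B(2,1) F] by blast
  define g where "g x = (\<Sum>a\<in>B. c a *\<^sub>R a x)" for x
  have g: "g \<in> V" unfolding g_def[abs_def] by (rule discrete_space_sum[OF V(1) B(2,1)])
  have "L2_inner D g v = F v" if v: "v \<in> V" for v
  proof -
    obtain k where k: "AE x in vol D. v x = (\<Sum>b\<in>B. k b *\<^sub>R b x)" using B(3)[OF v] by blast
    define w where "w x = (\<Sum>b\<in>B. k b *\<^sub>R b x)" for x
    have w: "w \<in> V" unfolding w_def[abs_def] by (rule discrete_space_sum[OF V(1) B(2,1)])
    have eq: "G v = (\<Sum>b\<in>B. k b * G b)" if G: "ae_linear D V G" for G
    proof -
      have "G v = G w" using k by (intro ae_linear_cong[OF G v w]) (simp add: w_def)
      also have "\<dots> = (\<Sum>b\<in>B. k b * G b)"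
        unfolding w_def[abs_def] by (rule ae_linear_sum[OF V(1) G B(2,1)])
      finally show ?thesis .
    qed
    have "ae_linear D V (L2_inner D g)" using ae_linear_L2_inner V(2) g by blast
    from eq[OF this] eq[OF F] show ?thesis using c by (simp add: g_def[abs_def])
  qed
  with g show ?thesis by blast
qed

text \<open>The difference lies in \<open>V\<close> and is therefore orthogonal to itself.\<close>

lemma discrete_space_eqI:
  assumes V: "discrete_space D V" "V \<subseteq> L2 D" and "g \<in> V" "h \<in> V"
    and "\<And>v. v \<in> V \<Longrightarrow> L2_inner D g v = L2_inner D h v"
  shows "AE x in vol D. g x = h x"
proof -
  have d: "(\<lambda>x. g x - h x) \<in> V" by (rule discrete_space_diff[OF V(1) assms(3,4)])
  have L: "g \<in> L2 D" "h \<in> L2 D" "(\<lambda>x. g x - h x) \<in> L2 D" using assms d by blast+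
  have "L2_inner D (\<lambda>x. g x - h x) (\<lambda>x. g x - h x) = 0"
    using L2_inner_diff_left[OF L] assms(5)[OF d] by simp
  then have "AE x in vol D. g x - h x = 0"
    using L2_inner_self_0[OF L(3)] by (simp add: L2_inner_def)
  then show ?thesis by simp
qed

lemma L2_proj_spec:
  assumes V: "discrete_space D V" "V \<subseteq> L2 D" and f: "f \<in> L2 D"
  shows "L2_proj D V f \<in> V" and "v \<in> V \<Longrightarrow> L2_inner D (L2_proj D V f) v = L2_inner D f v"
proof -
  have "\<exists>g. g \<in> V \<and> (\<forall>h\<in>V. (LINT x|vol D. g x \<bullet> h x) = (LINT x|vol D. f x \<bullet> h x))"
    using riesz_discrete[OF V ae_linear_L2_inner[OF f V(2)]] unfolding L2_inner_def by blast
  from someI_ex[OF this] show "L2_proj D V f \<in> V" "v \<in> V \<Longrightarrow> L2_inner D (L2_proj D V f) v = L2_inner D f v"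
    unfolding L2_proj_def L2_inner_def by auto
qed

lemma L2_proj_id:
  assumes V: "discrete_space D V" "V \<subseteq> L2 D" and f: "f \<in> V"
  shows "AE x in vol D. L2_proj D V f x = f x"
proof -
  have "f \<in> L2 D" using f V(2) by blast
  from L2_proj_spec[OF V this] show ?thesis by (intro discrete_space_eqI[OF V _ f]) auto
qed

text \<open>By Cauchy-Schwarz, convergence of the difference quotients in norm implies convergence
  of their products with the fixed \<open>v\<close>.\<close>

lemma has_field_derivative_L2_inner:
  assumes u: "\<And>t. t \<in> {0..T} \<Longrightarrow> u t \<in> L2 D \<and> u' t \<in> L2 D" and v: "v \<in> L2 D" and t: "t \<in> {0..T}"
    and lim: "((\<lambda>s. L2_norm D (\<lambda>x. (1 / (s - t)) *\<^sub>R (u s x - u t x) - u' t x)) \<longlongrightarrow> 0) (at t within {0..T})"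
  shows "((\<lambda>s. L2_inner D (u s) v) has_field_derivative L2_inner D (u' t) v) (at t within {0..T})"
  unfolding has_field_derivative_iff
proof -
  let ?F = "at t within {0..T}"
  let ?q = "\<lambda>s x. (1 / (s - t)) *\<^sub>R (u s x - u t x) - u' t x"
  have ev: "eventually (\<lambda>s. s \<in> {0..T}) ?F" by (auto simp: eventually_at_filter)
  have "((\<lambda>s. L2_inner D (?q s) v) \<longlongrightarrow> 0) ?F"
    unfolding L2_inner_def
  proof (rule L2_inner_tendsto_0[OF _ v lim])
    show "eventually (\<lambda>s. ?q s \<in> L2 D) ?F"
      using ev by eventually_elim (intro L2_diff L2_scaleR; use u t in blast)
  qed
  moreover have "eventually (\<lambda>s. L2_inner D (?q s) v =
      (L2_inner D (u s) v - L2_inner D (u t) v) / (s - t) - L2_inner D (u' t) v) ?F"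
    using ev
  proof eventually_elim
    case (elim s)
    then show ?case using u[OF t] u[OF elim] v
      by (simp only: L2_inner_diff_left L2_inner_scaleR_left L2_diff L2_scaleR) simp
  qed
  ultimately have "((\<lambda>s. (L2_inner D (u s) v - L2_inner D (u t) v) / (s - t) - L2_inner D (u' t) v) \<longlongrightarrow> 0) ?F"
    by (rule Lim_transform_eventually)
  then show "((\<lambda>s. (L2_inner D (u s) v - L2_inner D (u t) v) / (s - t)) \<longlongrightarrow> L2_inner D (u' t) v) ?F"
    by (simp add: LIM_zero_iff)
qed

lemma L2_integrable:
  assumes D: "admissible_domain D" and f: "f \<in> L2 D"
  shows "integrable (vol D) f"
proof -
  interpret finite_measure "vol D" by (rule finite_measure_vol[OF D])
  show ?thesis
  proof (rule Bochner_Integration.integrable_bound)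
    show "integrable (vol D) (\<lambda>x. (norm (f x))\<^sup>2 + 1)"
      using L2_square_integrable[OF f] by simp
    show "AE x in vol D. norm (f x) \<le> norm ((norm (f x))\<^sup>2 + 1)"
    proof (rule AE_I2)
      fix x
      have "2 * norm (f x) \<le> (norm (f x))\<^sup>2 + 1" using sum_squares_bound[of "norm (f x)" 1] by simp
      then have "norm (f x) \<le> (norm (f x))\<^sup>2 + 1" using norm_ge_zero[of "f x"] by linarith
      then show "norm (f x) \<le> norm ((norm (f x))\<^sup>2 + 1)" by simp
    qed
  qed (rule L2_measurable[OF f])
qed

text \<open>All that is used of the periodic setting: the fundamental lemma of the calculus of variations
  and the constant test function.\<close>

locale periodic_complex =
  fixes D :: flow_domain
    and V0h :: "(real^2 \<Rightarrow> real) set" and V1h :: "(real^2 \<Rightarrow> real^2) set" and V2h :: "(real^2 \<Rightarrow> real) set"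
  assumes adm: "admissible_domain D"
    and fundamental: "\<And>d. d \<in> L2 D \<Longrightarrow> (\<And>\<phi>. \<phi> \<in> test_functions D \<Longrightarrow> (LINT x|vol D. d x * \<phi> x) = 0)
      \<Longrightarrow> AE x in vol D. d x = 0"
    and one_test: "(\<lambda>x. 1) \<in> test_functions D"
    and V0: "discrete_space D V0h" "V0h \<subseteq> H1 D"
    and V1: "discrete_space D V1h" "V1h \<subseteq> Hdiv D"
    and V2: "discrete_space D V2h" "V2h \<subseteq> L2 D"
    and curl_V0: "w \<in> V0h \<Longrightarrow> weak_curl D w \<in> V1h"
    and div_V1: "v \<in> V1h \<Longrightarrow> weak_div D v \<in> V2h"
    and one_V2: "(\<lambda>x. 1) \<in> V2h"
    and axis_V1: "(\<lambda>x. axis k 1) \<in> V1h"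
begin

section \<open>Discrete gradient and discrete curl\<close>

lemma V0_L2: "V0h \<subseteq> L2 D" and V1_L2: "V1h \<subseteq> L2 D"
  using V0 V1 by (auto simp: H1_def Hdiv_def)

lemma weak_div_spec: "v \<in> Hdiv D \<Longrightarrow> has_weak_div D v (weak_div D v)"
  using someI_ex[of "has_weak_div D v"] by (simp add: Hdiv_def weak_div_def)

lemma weak_pd_spec: "w \<in> H1 D \<Longrightarrow> has_weak_pd D i w (weak_pd D i w)"
  using someI_ex[of "has_weak_pd D i w"] by (simp add: H1_def weak_pd_def)

text \<open>The difference of the two divergences is orthogonal to all test functions. Allowing two
  fields that agree almost everywhere also covers a change of representative.\<close>

lemma weak_div_unique:
  assumes vw: "v \<in> L2 D" "w \<in> L2 D" "AE x in vol D. v x = w x"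
    and d: "has_weak_div D v d" and e: "has_weak_div D w e"
  shows "AE x in vol D. d x = e x"
proof -
  have L: "d \<in> L2 D" "e \<in> L2 D" using d e by (auto simp: has_weak_div_def)
  have "AE x in vol D. d x - e x = 0"
  proof (rule fundamental)
    fix \<phi> assume \<phi>: "\<phi> \<in> test_functions D"
    note \<phi>L = test_function_in_L2[OF adm \<phi>]
    have "L2_inner D v (grad \<phi>) = L2_inner D w (grad \<phi>)"
      unfolding L2_inner_commute[of D _ "grad \<phi>"]
      by (rule L2_inner_cong_AE[OF grad_test_in_L2[OF adm \<phi>] vw])
    then have "(LINT x|vol D. d x * \<phi> x) = (LINT x|vol D. e x * \<phi> x)"
      using d e \<phi> by (simp add: has_weak_div_def L2_inner_def)
    then show "(LINT x|vol D. (d x - e x) * \<phi> x) = 0"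
      using L2_mult_integrable[OF L(1) \<phi>L] L2_mult_integrable[OF L(2) \<phi>L] by (simp add: left_diff_distrib)
  qed (rule L2_diff[OF L])
  then show ?thesis by simp
qed

lemma has_weak_div_add:
  assumes "v \<in> L2 D" "w \<in> L2 D" "has_weak_div D v d" "has_weak_div D w e"
  shows "has_weak_div D (\<lambda>x. v x + w x) (\<lambda>x. d x + e x)"
  using assms
  by (auto simp: has_weak_div_def inner_add_left distrib_right L2_add L2_inner_integrable
      L2_mult_integrable grad_test_in_L2[OF adm] test_function_in_L2[OF adm])

lemma has_weak_div_scaleR:
  assumes "has_weak_div D v d"
  shows "has_weak_div D (\<lambda>x. c *\<^sub>R v x) (\<lambda>x. c * d x)"
  using assms L2_scaleR[of d D c] by (auto simp: has_weak_div_def mult.assoc)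

text \<open>The chosen divergence of a sum and the sum of the chosen divergences are both weak
  divergences of the same field, so they agree almost everywhere; scaling is alike.\<close>

lemma ae_linear_div:
  assumes q: "q \<in> L2 D"
  shows "ae_linear D V1h (\<lambda>v. - L2_inner D q (weak_div D v))"
proof -
  have H: "v \<in> Hdiv D" "v \<in> L2 D" "weak_div D v \<in> L2 D" if "v \<in> V1h" for v
    using that V1_L2 V1 V2 div_V1 by blast+
  note cong = L2_inner_cong_AE[OF q]
  show ?thesis
    unfolding ae_linear_def
  proof (intro conjI ballI allI impI)
    fix f g assume f: "f \<in> V1h" and g: "g \<in> V1h"
    note fg = discrete_space_add[OF V1(1) f g]
    have "AE x in vol D. weak_div D (\<lambda>x. f x + g x) x = weak_div D f x + weak_div D g x"
      by (rule weak_div_unique[OF H(2)[OF fg] H(2)[OF fg]])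
         (auto intro!: weak_div_spec has_weak_div_add H f g fg)
    from cong[OF H(3)[OF fg] L2_add[OF H(3)[OF f] H(3)[OF g]] this]
    show "- L2_inner D q (weak_div D (\<lambda>x. f x + g x)) =
        - L2_inner D q (weak_div D f) + - L2_inner D q (weak_div D g)"
      by (simp add: L2_inner_add_right[OF q H(3)[OF f] H(3)[OF g]])
  next
    fix f and c :: real assume f: "f \<in> V1h"
    note cf = discrete_space_scaleR[OF V1(1) f, of c]
    have "AE x in vol D. weak_div D (\<lambda>x. c *\<^sub>R f x) x = c *\<^sub>R weak_div D f x"
      using weak_div_unique[OF H(2)[OF cf] H(2)[OF cf] _ weak_div_spec[OF H(1)[OF cf]]
        has_weak_div_scaleR[OF weak_div_spec[OF H(1)[OF f]]]] by simp
    from cong[OF H(3)[OF cf] L2_scaleR[OF H(3)[OF f]] this]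
    show "- L2_inner D q (weak_div D (\<lambda>x. c *\<^sub>R f x)) = c * - L2_inner D q (weak_div D f)"
      using L2_inner_scaleR_right[of D q c "weak_div D f"] by simp
  next
    fix f g assume f: "f \<in> V1h" and g: "g \<in> V1h" and ae: "AE x in vol D. f x = g x"
    have "AE x in vol D. weak_div D f x = weak_div D g x"
      by (rule weak_div_unique[OF _ _ ae]) (auto intro!: weak_div_spec H f g)
    from cong[OF H(3)[OF f] H(3)[OF g] this]
    show "- L2_inner D q (weak_div D f) = - L2_inner D q (weak_div D g)" by simp
  qed
qed

lemma grad_h_spec:
  assumes q: "q \<in> L2 D"
  shows "grad_h D V1h q \<in> V1h"
    and "v \<in> V1h \<Longrightarrow> L2_inner D (grad_h D V1h q) v = - L2_inner D q (weak_div D v)"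
proof -
  have "\<exists>g. g \<in> V1h \<and> (\<forall>v\<in>V1h. (LINT x|vol D. g x \<bullet> v x) = - (LINT x|vol D. q x * weak_div D v x))"
    using riesz_discrete[OF V1(1) V1_L2 ae_linear_div[OF q]] unfolding L2_inner_def inner_real_def by blast
  from someI_ex[OF this] show "grad_h D V1h q \<in> V1h"
    "v \<in> V1h \<Longrightarrow> L2_inner D (grad_h D V1h q) v = - L2_inner D q (weak_div D v)"
    unfolding grad_h_def L2_inner_def inner_real_def by auto
qed

text \<open>Under the hypothesis the zero function has the defining property, so the choice is
  legitimate; whatever is chosen is orthogonal to \<open>V0h\<close>, hence to itself.\<close>

lemma curl_h_eq_0:
  assumes "\<And>w. w \<in> V0h \<Longrightarrow> L2_inner D v (weak_curl D w) = 0"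
  shows "AE x in vol D. curl_h D V0h v x = 0"
proof -
  have "\<exists>z. z \<in> V0h \<and> (\<forall>w\<in>V0h. (LINT x|vol D. z x * w x) = (LINT x|vol D. v x \<bullet> weak_curl D w x))"
    using assms discrete_space_zero[OF V0(1)] by (intro exI[of _ "\<lambda>x. 0"]) (simp add: L2_inner_def)
  from someI_ex[OF this] have z: "curl_h D V0h v \<in> V0h"
    "\<And>w. w \<in> V0h \<Longrightarrow> (LINT x|vol D. curl_h D V0h v x * w x) = 0"
    unfolding curl_h_def using assms by (auto simp: L2_inner_def)
  show ?thesis
    using z(2)[OF z(1)] z(1) V0_L2 by (intro L2_inner_self_0) (auto simp: inner_real_def)
qed

lemma inner_weak_curl:
  "y \<bullet> weak_curl D w x = y $ 1 * weak_pd D 2 w x - y $ 2 * weak_pd D 1 w x"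
  by (simp add: weak_curl_def inner_vec_def sum_2)

text \<open>Derivatives of test functions are again test functions, so the weak derivatives of
  \<open>w\<close> can be moved across once more; the two resulting mixed derivatives
  cancel.\<close>

lemma has_weak_div_weak_curl:
  assumes w: "w \<in> H1 D"
  shows "has_weak_div D (weak_curl D w) (\<lambda>x. 0)"
proof -
  have wp: "weak_pd D i w \<in> L2 D"
    "\<phi> \<in> test_functions D \<Longrightarrow> (LINT x|vol D. w x * pd i \<phi> x) = - (LINT x|vol D. weak_pd D i w x * \<phi> x)" for i \<phi>
    using weak_pd_spec[OF w, of i] by (auto simp: has_weak_pd_def)
  have "(LINT x|vol D. weak_curl D w x \<bullet> grad \<phi> x) = 0" if \<phi>: "\<phi> \<in> test_functions D" for \<phi>
  proof -
    note tp = test_pd[OF \<phi>]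
    have "(LINT x|vol D. weak_curl D w x \<bullet> grad \<phi> x)
        = (LINT x|vol D. weak_pd D 2 w x * pd 1 \<phi> x - weak_pd D 1 w x * pd 2 \<phi> x)"
      by (simp add: inner_commute[of "weak_curl D w _"] inner_weak_curl grad_def mult.commute)
    also have "\<dots> = (LINT x|vol D. weak_pd D 2 w x * pd 1 \<phi> x) - (LINT x|vol D. weak_pd D 1 w x * pd 2 \<phi> x)"
      by (intro Bochner_Integration.integral_diff L2_mult_integrable wp test_function_in_L2[OF adm] tp)
    also have "\<dots> = (LINT x|vol D. w x * pd 1 (pd 2 \<phi>) x) - (LINT x|vol D. w x * pd 2 (pd 1 \<phi>) x)"
      using wp(2)[OF tp, of 2 1] wp(2)[OF tp, of 1 2] by linarith
    also have "\<dots> = 0" by (simp add: pd_commute[OF test_smooth[OF \<phi>], of 1 2])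
    finally show ?thesis .
  qed
  moreover have "(\<lambda>x. 0) \<in> L2 D" by (intro continuous_in_L2 adm continuous_intros)
  ultimately show ?thesis by (simp add: has_weak_div_def)
qed

text \<open>Dual to \<open>div curl = 0\<close>: testing with \<open>w\<close> gives minus the
  product of \<open>q\<close> with the divergence of a curl.\<close>

lemma curl_h_grad_h:
  assumes q: "q \<in> L2 D"
  shows "AE x in vol D. curl_h D V0h (grad_h D V1h q) x = 0"
proof (rule curl_h_eq_0)
  fix w assume w: "w \<in> V0h"
  note c = curl_V0[OF w]
  have cL: "weak_curl D w \<in> L2 D" "weak_curl D w \<in> Hdiv D" using c V1_L2 V1 by blast+
  have "AE x in vol D. weak_div D (weak_curl D w) x = 0"
    by (rule weak_div_unique[OF cL(1) cL(1) _ weak_div_spec[OF cL(2)]])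
       (use w V0 in \<open>auto intro!: has_weak_div_weak_curl\<close>)
  then show "L2_inner D (grad_h D V1h q) (weak_curl D w) = 0"
    by (simp add: grad_h_spec(2)[OF q c] L2_inner_zero_AE)
qed

lemma pd_one: "pd i (\<lambda>x. 1) = (\<lambda>x. 0)"
  by (rule ext) (simp add: pd_eqI[OF has_derivative_const])

text \<open>Testing with the constant 1 shows that weak partial derivatives have mean zero, hence so
  does every component of \<open>weak_curl D w\<close>.\<close>

lemma curl_h_axis: "AE x in vol D. curl_h D V0h (\<lambda>x. axis k 1) x = 0"
proof (rule curl_h_eq_0)
  fix w assume "w \<in> V0h"
  then have w: "w \<in> H1 D" using V0 by blast
  have wp: "weak_pd D i w \<in> L2 D" "(LINT x|vol D. weak_pd D i w x) = 0" for i
  proof -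
    have "weak_pd D i w \<in> L2 D \<and>
        (LINT x|vol D. w x * pd i (\<lambda>x. 1) x) = - (LINT x|vol D. weak_pd D i w x * 1)"
      using weak_pd_spec[OF w, of i] one_test unfolding has_weak_pd_def by blast
    then show "weak_pd D i w \<in> L2 D" "(LINT x|vol D. weak_pd D i w x) = 0" by (simp_all add: pd_one)
  qed
  show "L2_inner D (\<lambda>x. axis k 1) (weak_curl D w) = 0"
  proof -
    have ii: "integrable (vol D) (\<lambda>x. c * weak_pd D i w x)" for c i
      by (rule integrable_mult_right[OF L2_integrable[OF adm wp(1)]])
    have zz: "(LINT x|vol D. c * weak_pd D i w x) = 0" for c i
      using wp(2)[of i] by (simp only: integral_mult_right_zero mult_zero_right)
    have "L2_inner D (\<lambda>x. axis k 1) (weak_curl D w)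
        = (LINT x|vol D. axis k 1 $ 1 * weak_pd D 2 w x - axis k 1 $ 2 * weak_pd D 1 w x)"
      by (simp only: L2_inner_def inner_weak_curl)
    also have "\<dots> = 0"
      using Bochner_Integration.integral_diff[OF ii ii] by (simp only: zz diff_self)
    finally show ?thesis .
  qed
qed

lemma weak_div_axis: "AE x in vol D. weak_div D (\<lambda>x. axis k 1) x = 0"
proof -
  have e: "(\<lambda>x. axis k 1 :: real^2) \<in> L2 D" "(\<lambda>x. axis k 1) \<in> Hdiv D"
    using axis_V1[of k] V1_L2 V1 by auto
  have "has_weak_div D (\<lambda>x. axis k 1) (\<lambda>x. 0)"
    using integral_test_pd[OF adm, of _ k]
    by (auto simp: has_weak_div_def inner_axis' grad_def intro!: continuous_in_L2 adm)
  from weak_div_unique[OF e(1) e(1) _ weak_div_spec[OF e(2)] this] show ?thesis by simp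
qed

text \<open>Testing with the constant 1 shows that every field in \<open>V1h\<close> has a
  divergence of mean zero.\<close>

lemma grad_h_const:
  assumes q: "q \<in> L2 D" "AE x in vol D. q x = c"
  shows "AE x in vol D. grad_h D V1h q x = 0"
proof (rule discrete_space_eqI[OF V1(1) V1_L2 grad_h_spec(1)[OF q(1)] discrete_space_zero[OF V1(1)]])
  fix v assume v: "v \<in> V1h"
  have c: "(\<lambda>x. c) \<in> L2 D" by (intro continuous_in_L2 adm continuous_intros)
  have d: "weak_div D v \<in> L2 D" using div_V1[OF v] V2 by blast
  have hw: "has_weak_div D v (weak_div D v)" using v V1 weak_div_spec by blast
  have "(LINT x|vol D. v x \<bullet> grad (\<lambda>x. 1) x) = - (LINT x|vol D. weak_div D v x * 1)"
    using hw one_test unfolding has_weak_div_def by blast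
  then have "(LINT x|vol D. weak_div D v x) = 0"
    by (simp add: grad_def pd_one zero_vec_def[symmetric])
  then have "L2_inner D (weak_div D v) (\<lambda>x. c) = 0" by (simp add: L2_inner_def)
  moreover have "L2_inner D (weak_div D v) q = L2_inner D (weak_div D v) (\<lambda>x. c)"
    by (rule L2_inner_cong_AE[OF d q(1) c q(2)])
  ultimately show "L2_inner D (grad_h D V1h q) v = L2_inner D (\<lambda>x. 0) v"
    using grad_h_spec(2)[OF q(1) v] by (simp add: L2_inner_commute[of D q]) (simp add: L2_inner_def)
qed

section \<open>The convective form tested with constant fields\<close>

lemma interior_h_V2: "u \<in> L2 D \<Longrightarrow> interior_h D V2h (axis k 1) u \<in> V2h"
  unfolding interior_h_def inner_axis' by (rule L2_proj_spec(1)[OF V2]) (simp add: L2_component)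

lemma interior_h_axis:
  "AE x in vol D. interior_h D V2h (axis k 1) (\<lambda>x. axis i 1) x = (if k = i then 1 else 0)"
proof -
  have eq: "axis k 1 \<bullet> (axis i 1 :: real^2) = (if k = i then 1 else 0)"
    by (simp add: inner_axis_axis inner_real_def)
  have "(\<lambda>x. (if k = i then 1 else 0) *\<^sub>R 1) \<in> V2h" by (rule discrete_space_scaleR[OF V2(1) one_V2])
  then have "(\<lambda>x. if k = i then 1 else 0) \<in> V2h" by (simp only: real_scaleR_def mult_1_right)
  from L2_proj_id[OF V2 this] show ?thesis by (simp only: interior_h_def eq)
qed

text \<open>The interior products of \<open>e_i\<close> are the constants 0 and 1. Their discrete
  gradients vanish, which removes the second half of the sum, and among the first half only
  \<open>k = i\<close> survives.\<close>

lemma s_h_axis: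
  assumes u: "u \<in> L2 D"
  shows "AE x in vol D. s_h D V1h V2h u (\<lambda>x. axis i 1) x = (1/2) *\<^sub>R grad_h D V1h (interior_h D V2h (axis i 1) u) x"
proof -
  let ?I = "\<lambda>k. interior_h D V2h (axis k 1)" and ?e = "\<lambda>x. axis i 1 :: real^2"
  let ?f = "\<lambda>y. \<Sum>k\<in>UNIV. ?I k ?e y *\<^sub>R grad_h D V1h (?I k u) y - ?I k u y *\<^sub>R grad_h D V1h (?I k ?e) y"
  have e: "?e \<in> L2 D" using axis_V1 V1_L2 by blast
  have I: "?I k v \<in> L2 D" if "v \<in> L2 D" for k v using interior_h_V2[OF that] V2 by blast
  have g0: "AE y in vol D. grad_h D V1h (?I k ?e) y = 0" for k
    by (rule grad_h_const[OF I[OF e] interior_h_axis])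
  have ae: "AE y in vol D. grad_h D V1h (?I i u) y = ?f y"
    using g0[of 1] g0[of 2] interior_h_axis[of 1 i] interior_h_axis[of 2 i]
  proof eventually_elim
    case (elim y)
    then show ?case using exhaust_2[of i] by (auto simp: sum_2)
  qed
  \<comment> \<open>A product of discrete functions need not lie in \<open>V1h\<close>; this sum
    does, being a discrete gradient up to a null set, so the outer projection leaves it
    unchanged.\<close>
  have fV: "?f \<in> V1h" by (rule discrete_space_AE[OF V1(1) grad_h_spec(1)[OF I[OF u]] ae])
  show ?thesis
    using L2_proj_id[OF V1(1) V1_L2 fV] ae unfolding s_h_def by eventually_elim simp
qed

lemma inner_s_h_axis:
  assumes u: "u \<in> V1h"
  shows "L2_inner D u (s_h D V1h V2h u (\<lambda>x. axis i 1))
    = (1/2) * L2_inner D u (grad_h D V1h (interior_h D V2h (axis i 1) u))"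
proof -
  have uL: "u \<in> L2 D" using u V1_L2 by blast
  let ?g = "grad_h D V1h (interior_h D V2h (axis i 1) u)"
  have g: "?g \<in> V1h" using interior_h_V2[OF uL] V2 by (intro grad_h_spec) blast
  then have hg: "(\<lambda>x. (1/2) *\<^sub>R ?g x) \<in> V1h" by (rule discrete_space_scaleR[OF V1(1)])
  have "s_h D V1h V2h u (\<lambda>x. axis i 1) \<in> V1h"
    by (rule discrete_space_AE[OF V1(1) hg]) (use s_h_axis[OF uL] in \<open>auto simp: eq_commute\<close>)
  then have "L2_inner D u (s_h D V1h V2h u (\<lambda>x. axis i 1)) = L2_inner D u (\<lambda>x. (1/2) *\<^sub>R ?g x)"
    using hg V1_L2 by (intro L2_inner_cong_AE uL s_h_axis) blast+
  then show ?thesis by (simp only: L2_inner_scaleR_right)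
qed

end

section \<open>Conservation of momentum\<close>

lemma conforming_spaces_periodic:
  assumes conf: "conforming_spaces D V0h V1h V2h"
    and one: "(\<lambda>x. 1) \<in> V2h" and e: "\<And>k. (\<lambda>x. axis k 1) \<in> V1h"
  shows "periodic_complex D V0h V1h V2h"
proof (cases D)
  case (Homogeneous W)
  then have "V1h \<subseteq> Hdiv_zero (Homogeneous W)" "admissible_domain (Homogeneous W)"
    using conf by (auto simp: conforming_spaces_def)
  then show ?thesis using e homogeneous_no_constant_field by blast
next
  case (Periodic a b)
  have D: "admissible_domain D" using conf by (simp add: conforming_spaces_def)
  show ?thesis
  proof
    show "AE x in vol D. d x = 0" if "d \<in> L2 D"
      "\<And>\<phi>. \<phi> \<in> test_functions D \<Longrightarrow> (LINT x|vol D. d x * \<phi> x) = 0" for d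
      using periodic_fundamental_lemma[of a b d] D that unfolding Periodic by blast
    show "(\<lambda>x. 1) \<in> test_functions D"
      by (simp add: Periodic smooth_def Ck_const)
    show "V0h \<subseteq> H1 D" "V1h \<subseteq> Hdiv D" "V2h \<subseteq> L2 D"
      using conf Periodic by (auto simp: conforming_spaces_def V2_def)
  qed (use conf one e D in \<open>auto simp: conforming_spaces_def\<close>)
qed

theorem proposition5:
  fixes D :: flow_domain
    and V0h :: "(real^2 \<Rightarrow> real) set"
    and V1h :: "(real^2 \<Rightarrow> real^2) set"
    and V2h :: "(real^2 \<Rightarrow> real) set"
    and \<nu> T :: real
    and u u' :: "real \<Rightarrow> real^2 \<Rightarrow> real^2"
    and p :: "real \<Rightarrow> real^2 \<Rightarrow> real"
  assumes "conforming_spaces D V0h V1h V2h"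
    and "(\<lambda>x. 1) \<in> V2h"
    and "\<And>k. (\<lambda>x. axis k 1) \<in> V1h"
    and "\<nu> \<ge> 0" and "T > 0"
    and "C1_curve D T V1h u u'"
    and "\<And>t. t \<in> {0..T} \<Longrightarrow> p t \<in> V2h"
    and "AE x in vol D. weak_div D (u 0) x = 0"
    and "\<And>t v. t \<in> {0..T} \<Longrightarrow> v \<in> V1h \<Longrightarrow>
           (LINT x|vol D. u' t x \<bullet> v x)
         + (LINT x|vol D. u t x \<bullet> s_h D V1h V2h (u t) v x)
         + (LINT x|vol D. grad_h D V1h (p t) x \<bullet> v x)
         + \<nu> * (LINT x|vol D. curl_h D V0h (u t) x * curl_h D V0h v x) = 0"
    and "\<And>t q. t \<in> {0..T} \<Longrightarrow> q \<in> V2h \<Longrightarrow>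
           (LINT x|vol D. u t x \<bullet> s_h D V1h V2h (u t) (grad_h D V1h q) x)
         + (LINT x|vol D. grad_h D V1h (p t) x \<bullet> grad_h D V1h q x) = 0"
  shows "\<forall>t\<in>{0..T}. ((\<lambda>s. LINT x|vol D. u s x) has_vector_derivative 0) (at t within {0..T})"
proof -
  interpret periodic_complex D V0h V1h V2h
    by (rule conforming_spaces_periodic) (rule assms)+
  have curve: "u t \<in> V1h" "u' t \<in> V1h" "u t \<in> L2 D" "u' t \<in> L2 D" if "t \<in> {0..T}" for t
    using assms(6) that V1_L2 by (auto simp: C1_curve_def)
  have momentum: "L2_inner D (u' t) v + L2_inner D (u t) (s_h D V1h V2h (u t) v)
      + L2_inner D (grad_h D V1h (p t)) v + \<nu> * L2_inner D (curl_h D V0h (u t)) (curl_h D V0h v) = 0"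
    if "t \<in> {0..T}" "v \<in> V1h" for t v
    using assms(9)[OF that] by (simp add: L2_inner_def)
  have deriv: "((\<lambda>s. L2_inner D (u s) v) has_field_derivative L2_inner D (u' t) v) (at t within {0..T})"
    if "t \<in> {0..T}" "v \<in> V1h" for t v
  proof (rule has_field_derivative_L2_inner[OF _ _ that(1)])
    show "v \<in> L2 D" using that V1_L2 by blast
    show "((\<lambda>s. L2_norm D (\<lambda>x. (1 / (s - t)) *\<^sub>R (u s x - u t x) - u' t x)) \<longlongrightarrow> 0) (at t within {0..T})"
      using assms(6) that(1) by (simp add: C1_curve_def)
  qed (use curve in blast)
  have div_free: "L2_inner D (u t) (grad_h D V1h q) = 0" if t: "t \<in> {0..T}" and q: "q \<in> V2h" for t q
  proof -
    have qL: "q \<in> L2 D" using q V2 by blast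
    note g = grad_h_spec(1)[OF qL]
    have "((\<lambda>s. L2_inner D (u s) (grad_h D V1h q)) has_field_derivative 0) (at s within {0..T})"
      if s: "s \<in> {0..T}" for s
    proof -
      have "L2_inner D (curl_h D V0h (u s)) (curl_h D V0h (grad_h D V1h q)) = 0"
        by (rule L2_inner_zero_AE[OF curl_h_grad_h[OF qL]])
      \<comment> \<open>Subtracting the pressure equation from the momentum equation cancels the
        convective and the pressure term together.\<close>
      then have "L2_inner D (u' s) (grad_h D V1h q) = 0"
        using momentum[OF s g] assms(10)[OF s q] by (simp add: L2_inner_def)
      with deriv[OF s g] show ?thesis by simp
    qed
    then obtain c where c: "\<And>s. s \<in> {0..T} \<Longrightarrow> L2_inner D (u s) (grad_h D V1h q) = c"
      using has_field_derivative_zero_constant[of "{0..T}" "\<lambda>s. L2_inner D (u s) (grad_h D V1h q)"]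
        convex_real_interval(5) by blast
    have z: "0 \<in> {0..T}" using assms(5) by simp
    \<comment> \<open>The initial condition enters here: by duality the product is minus the
      integral of \<open>q\<close> times the divergence of \<open>u 0\<close>.\<close>
    have "L2_inner D (u 0) (grad_h D V1h q) = 0"
      using grad_h_spec(2)[OF qL curve(1)[OF z]] L2_inner_zero_AE[OF assms(8)]
      by (simp add: L2_inner_commute[of D "u 0"])
    then show ?thesis using c[OF z] c[OF t] by simp
  qed
  have momentum0: "L2_inner D (u' t) (\<lambda>x. axis k 1) = 0" if t: "t \<in> {0..T}" for t k
  proof -
    have pL: "p t \<in> L2 D" using assms(7)[OF t] V2 by blast
    \<comment> \<open>The function \<open>q\<close> was fixed while differentiating in time. Now it
      is taken to be the projected component of \<open>u t\<close>, which depends on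
      \<open>t\<close>; orthogonality at this instant holds for every \<open>q\<close>.\<close>
    have "L2_inner D (u t) (s_h D V1h V2h (u t) (\<lambda>x. axis k 1)) = 0"
      using inner_s_h_axis[OF curve(1)[OF t]] div_free[OF t interior_h_V2[OF curve(3)[OF t]]] by simp
    moreover have "L2_inner D (grad_h D V1h (p t)) (\<lambda>x. axis k 1) = 0"
      using grad_h_spec(2)[OF pL axis_V1] L2_inner_zero_AE[OF weak_div_axis] by simp
    \<comment> \<open>One factor vanishes almost everywhere, so the product does, whatever
      \<open>curl_h D V0h (u t)\<close> is.\<close>
    moreover have "L2_inner D (curl_h D V0h (u t)) (curl_h D V0h (\<lambda>x. axis k 1)) = 0"
      by (rule L2_inner_zero_AE[OF curl_h_axis])
    ultimately show ?thesis using momentum[OF t axis_V1, of k] by simp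
  qed
  \<comment> \<open>The momentum is a vector-valued integral; its components are the products with
    constant fields, whose time derivatives are known.\<close>
  have component: "L2_inner D (u t) (\<lambda>x. axis k 1) = (LINT x|vol D. u t x) \<bullet> axis k 1" if "t \<in> {0..T}" for t k
    unfolding L2_inner_def
    by (rule integral_inner_left) (rule L2_integrable[OF adm curve(3)[OF that]])
  show ?thesis
  proof
    fix t assume t: "t \<in> {0..T}"
    show "((\<lambda>s. LINT x|vol D. u s x) has_vector_derivative 0) (at t within {0..T})"
      unfolding has_vector_derivative_def
    proof (subst has_derivative_componentwise_within, rule ballI)
      fix i :: "real^2" assume "i \<in> Basis"
      then obtain k where i: "i = axis k 1" by (auto simp: Basis_vec_def)
      have "((\<lambda>s. L2_inner D (u s) (\<lambda>x. axis k 1)) has_field_derivative 0) (at t within {0..T})"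
        using deriv[OF t axis_V1] by (simp add: momentum0[OF t])
      then have "((\<lambda>s. L2_inner D (u s) (\<lambda>x. axis k 1)) has_derivative (\<lambda>h. 0)) (at t within {0..T})"
        unfolding has_field_derivative_def by (rule has_derivative_eq_rhs) (simp add: fun_eq_iff)
      then have "((\<lambda>s. (LINT x|vol D. u s x) \<bullet> axis k 1) has_derivative (\<lambda>h. 0)) (at t within {0..T})"
        by (rule has_derivative_transform[OF t, rotated]) (rule component[symmetric])
      then show "((\<lambda>s. (LINT x|vol D. u s x) \<bullet> i) has_derivative (\<lambda>h. (h *\<^sub>R 0) \<bullet> i)) (at t within {0..T})"
        by (simp add: i)
    qed
  qed
qed

end
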